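(* Let $n\ge1$, let $\psi:[0,\infty)\to[0,\infty)$ be an increasing (not necessarily continuous) function such that $\psi(x)\to\infty$ as $x\to\infty$, and let $$I=\int_0^\infty\frac{\psi(x)}{1+x^2}\,dx.$$ (a) If $I=+\infty$ and $\mu$ is a complex (finite) Borel measure on $\mathbb{R}^n$ satisfying $$\int_{\mathbb{R}^n}e^{\psi(|x|)}\,d|\mu|(x)<\infty$$ such that $\widehat{\mu}$ vanishes on a set $\Lambda=\Lambda_1\times\cdots\times\Lambda_n\subset\mathbb{R}^n$, where each $\Lambda_j\subset\mathbb{R}$ is a closed set of positive Lebesgue measure, then $\mu$ is identically zero. (b) If $I<+\infty$, then there exists a non-trivial complex Borel measure $\mu$ on $\mathbb{R}^n$ satisfying $\int_{\mathbb{R}^n}e^{\psi(|x|)}\,d|\mu|(x)<\infty$ such that $\widehat{\mu}$ vanishes on a set of the form $\Lambda_1\times\cdots\times\Lambda_n$, where each $\Lambda_j\subset\mathbb{R}$ is a closed set of positive Lebesgue measure.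
   Context: $|x|$ is the Euclidean norm and $x\cdot y$ the Euclidean inner product on $\mathbb{R}^n$. "Increasing" means $x\le y\Rightarrow\psi(x)\le\psi(y)$. $|\mu|$ is the total variation measure of $\mu$, and $\widehat{\mu}(\lambda)=\int_{\mathbb{R}^n}e^{-i\lambda\cdot x}\,d\mu(x)$ for $\lambda\in\mathbb{R}^n$. *)

theory Defs
  imports "HOL-Analysis.Analysis"
begin

text \<open>
  A complex measure is a countably additive complex-valued set function on \<open>sets M\<close>; only the
  \<open>\<sigma>\<close>-algebra of \<open>M\<close> matters here. Finiteness is built in (the values lie in \<open>\<complex>\<close>), and applying the
  condition to a constantly empty sequence gives \<open>\<mu> {} = 0\<close>. Values of \<open>\<mu>\<close> outside \<open>sets M\<close> are
  irrelevant.
\<close>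

definition complex_measure :: "'a measure \<Rightarrow> ('a set \<Rightarrow> complex) \<Rightarrow> bool" where
  "complex_measure M \<mu> \<longleftrightarrow>
     (\<forall>A :: nat \<Rightarrow> 'a set. range A \<subseteq> sets M \<longrightarrow> disjoint_family A \<longrightarrow>
        (\<lambda>i. \<mu> (A i)) sums \<mu> (\<Union>i. A i))"

definition countable_partitions :: "'a measure \<Rightarrow> 'a set \<Rightarrow> (nat \<Rightarrow> 'a set) set" where
  "countable_partitions M E = {A. range A \<subseteq> sets M \<and> disjoint_family A \<and> (\<Union>i. A i) = E}"

text \<open>
  The supremum below is countably additive whenever \<open>\<mu>\<close> is a complex measure, so \<open>measure_of\<close> does
  not collapse to the null measure; see \<open>emeasure_total_variation\<close>.
\<close>

definition total_variation :: "'a measure \<Rightarrow> ('a set \<Rightarrow> complex) \<Rightarrow> 'a measure" where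
  "total_variation M \<mu> = measure_of (space M) (sets M)
     (\<lambda>E. SUP A\<in>countable_partitions M E. \<Sum>i. ennreal (cmod (\<mu> (A i))))"

text \<open>
  The Radon-Nikodym density of \<open>\<mu>\<close> with respect to its total variation, i.e. the factor in the
  polar decomposition of \<open>\<mu>\<close>. Only its almost-everywhere class, which is unique, matters for
  integrals; for existence see \<open>polar_density_density\<close>.
\<close>

definition polar_density :: "'a measure \<Rightarrow> ('a set \<Rightarrow> complex) \<Rightarrow> 'a \<Rightarrow> complex" where
  "polar_density M \<mu> = (SOME h. integrable (total_variation M \<mu>) h \<and>
     (\<forall>E\<in>sets M. \<mu> E = (LINT x:E|total_variation M \<mu>. h x)))"

definition complex_measure_integral ::
    "'a measure \<Rightarrow> ('a set \<Rightarrow> complex) \<Rightarrow> ('a \<Rightarrow> complex) \<Rightarrow> complex" where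
  "complex_measure_integral M \<mu> f = (LINT x|total_variation M \<mu>. f x * polar_density M \<mu> x)"

definition fourier_transform ::
    "('a::euclidean_space set \<Rightarrow> complex) \<Rightarrow> 'a \<Rightarrow> complex" where
  "fourier_transform \<mu> l =
     complex_measure_integral borel \<mu> (\<lambda>x. exp (- (\<i> * complex_of_real (l \<bullet> x))))"

lemma sets_total_variation [simp, measurable_cong]: "sets (total_variation M \<mu>) = sets M"
  by (simp add: total_variation_def)

lemma space_total_variation [simp]: "space (total_variation M \<mu>) = space M"
  by (simp add: total_variation_def)

lemma complex_measure_empty:
  assumes "complex_measure M \<mu>"
  shows "\<mu> {} = 0"
proof -
  have "(\<lambda>i::nat. \<mu> {}) sums \<mu> (\<Union>i::nat. {})"
    using assms unfolding complex_measure_def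
    by (elim allE[of _ "\<lambda>_. {}"]) (simp add: disjoint_family_on_def)
  then have "(\<lambda>i::nat. \<mu> {}) \<longlonglongrightarrow> 0"
    using sums_summable summable_LIMSEQ_zero by blast
  then show ?thesis
    by (simp add: LIMSEQ_const_iff)
qed

definition variation_sup :: "'a measure \<Rightarrow> ('a set \<Rightarrow> complex) \<Rightarrow> 'a set \<Rightarrow> ennreal" where
  "variation_sup M \<mu> E = (SUP A\<in>countable_partitions M E. \<Sum>i. ennreal (cmod (\<mu> (A i))))"

lemma trivial_countable_partition:
  assumes "E \<in> sets M"
  shows "(\<lambda>i. if i = 0 then E else {}) \<in> countable_partitions M E"
  using assms by (auto simp: countable_partitions_def disjoint_family_on_def split: if_splits)

lemma norm_le_variation_sup:
  assumes "complex_measure M \<mu>" "E \<in> sets M"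
  shows "ennreal (cmod (\<mu> E)) \<le> variation_sup M \<mu> E"
proof -
  let ?A = "\<lambda>i::nat. if i = 0 then E else {}"
  have "(\<Sum>i. ennreal (cmod (\<mu> (?A i)))) = (\<Sum>i\<in>{0}. ennreal (cmod (\<mu> (?A i))))"
    by (rule suminf_finite) (auto simp: complex_measure_empty[OF assms(1)])
  then have eq: "(\<Sum>i. ennreal (cmod (\<mu> (?A i)))) = ennreal (cmod (\<mu> E))"
    by simp
  show ?thesis
    unfolding variation_sup_def
    by (rule SUP_upper2[OF trivial_countable_partition[OF assms(2)]]) (simp only: eq order_refl)
qed

lemma variation_sup_superadditive:
  assumes cm: "complex_measure M \<mu>"
    and E: "E \<in> sets M" and F: "F \<in> sets M" and EF: "E \<inter> F = {}"
  shows "variation_sup M \<mu> E + variation_sup M \<mu> F \<le> variation_sup M \<mu> (E \<union> F)"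
proof -
  let ?s = "\<lambda>A. \<Sum>i::nat. ennreal (cmod (\<mu> (A i)))"
  have ne: "countable_partitions M E \<noteq> {}" "countable_partitions M F \<noteq> {}"
    using trivial_countable_partition E F by blast+
  have key: "?s A + ?s B \<le> variation_sup M \<mu> (E \<union> F)"
    if A: "A \<in> countable_partitions M E" and B: "B \<in> countable_partitions M F" for A B
  proof -
    from A have A_sets: "range A \<subseteq> sets M" and A_disj: "disjoint_family A"
      and A_Un: "(\<Union>j. A j) = E"
      by (simp_all add: countable_partitions_def)
    from B have B_sets: "range B \<subseteq> sets M" and B_disj: "disjoint_family B"
      and B_Un: "(\<Union>j. B j) = F"
      by (simp_all add: countable_partitions_def)
    define D where "D = (\<lambda>(i::nat, j). if i = 0 then A j else if i = 1 then B j else {})"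
    define C where "C = (\<lambda>k. D (prod_decode k))"
    have "disjoint_family C"
    proof (unfold disjoint_family_on_def, intro ballI impI)
      fix k l :: nat assume "k \<noteq> l"
      then have ne: "prod_decode k \<noteq> prod_decode l"
        by (metis prod_decode_inverse)
      obtain a b where ab: "prod_decode k = (a, b)" by (cases "prod_decode k")
      obtain c d where cd: "prod_decode l = (c, d)" by (cases "prod_decode l")
      have 1: "A i \<inter> A j = {}" "B i \<inter> B j = {}" if "i \<noteq> j" for i j
        using A_disj B_disj that unfolding disjoint_family_on_def by blast+
      have 2: "A i \<inter> B j = {}" for i j
        using A_Un B_Un EF by blast
      show "C k \<inter> C l = {}"
      proof (cases "a = c")
        case True
        with ne ab cd have "b \<noteq> d" by simp
        then show ?thesis
          using 1[of b d] True by (simp add: C_def D_def ab cd)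
      next
        case False
        then show ?thesis
          using 2[of b d] 2[of d b] by (simp add: C_def D_def ab cd Int_commute[of "B b" "A d"])
      qed
    qed
    moreover have "range C \<subseteq> sets M"
    proof -
      have "A j \<in> sets M" "B j \<in> sets M" for j
        using A_sets B_sets by blast+
      then have "D p \<in> sets M" for p
        by (cases p) (simp add: D_def)
      then show ?thesis unfolding C_def by blast
    qed
    moreover have "(\<Union>k. C k) = E \<union> F"
    proof -
      have "(\<Union>k. C k) = (\<Union>p. D p)"
      proof (intro equalityI subsetI)
        fix x assume "x \<in> (\<Union>p. D p)"
        then obtain p where "x \<in> D p" by blast
        then have "x \<in> C (prod_encode p)" by (simp add: C_def)
        then show "x \<in> (\<Union>k. C k)" by blast
      next
        fix x assume "x \<in> (\<Union>k. C k)"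
        then show "x \<in> (\<Union>p. D p)" unfolding C_def by blast
      qed
      also have "\<dots> = (\<Union>j. A j) \<union> (\<Union>j. B j)"
      proof (intro equalityI subsetI)
        fix x assume "x \<in> (\<Union>j. A j) \<union> (\<Union>j. B j)"
        then obtain j where "x \<in> A j \<or> x \<in> B j" by blast
        then have "x \<in> D (0, j) \<or> x \<in> D (1, j)" by (simp add: D_def)
        then show "x \<in> (\<Union>p. D p)" by blast
      next
        fix x assume "x \<in> (\<Union>p. D p)"
        then obtain i j where "x \<in> D (i, j)" by (metis UN_E surj_pair)
        then have "x \<in> A j \<or> x \<in> B j" by (simp add: D_def split: if_splits)
        then show "x \<in> (\<Union>j. A j) \<union> (\<Union>j. B j)" by blast
      qed
      finally show ?thesis
        by (simp only: A_Un B_Un)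
    qed
    ultimately have "C \<in> countable_partitions M (E \<union> F)"
      by (simp add: countable_partitions_def)
    then have le: "?s C \<le> variation_sup M \<mu> (E \<union> F)"
      unfolding variation_sup_def by (rule SUP_upper)
    have "?s C = (\<Sum>i. \<Sum>j. ennreal (cmod (\<mu> (D (i, j)))))"
      unfolding C_def
      by (rule suminf_ennreal_2dimen[of _ "\<lambda>p. ennreal (cmod (\<mu> (D p)))"]) (rule refl)
    also have "\<dots> = (\<Sum>i\<in>{0, 1}. \<Sum>j. ennreal (cmod (\<mu> (D (i, j)))))"
      by (rule suminf_finite) (auto simp: D_def complex_measure_empty[OF cm])
    also have "\<dots> = ?s A + ?s B"
      by (simp add: D_def)
    finally show ?thesis using le by simp
  qed
  have "variation_sup M \<mu> E + variation_sup M \<mu> F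
      = (SUP A\<in>countable_partitions M E. ?s A + variation_sup M \<mu> F)"
    unfolding variation_sup_def[of M \<mu> E]
    by (rule ennreal_SUP_add_left[OF ne(1), symmetric])
  also have "\<dots> \<le> variation_sup M \<mu> (E \<union> F)"
  proof (rule SUP_least)
    fix A assume A: "A \<in> countable_partitions M E"
    have "?s A + variation_sup M \<mu> F = (SUP B\<in>countable_partitions M F. ?s A + ?s B)"
      unfolding variation_sup_def[of M \<mu> F]
      by (rule ennreal_SUP_add_right[OF ne(2)])
    also have "\<dots> \<le> variation_sup M \<mu> (E \<union> F)"
      by (rule SUP_least) (rule key[OF A])
    finally show "?s A + variation_sup M \<mu> F \<le> variation_sup M \<mu> (E \<union> F)" .
  qed
  finally show ?thesis .
qed

lemma variation_sup_mono:
  assumes cm: "complex_measure M \<mu>" and "E \<in> sets M" "F \<in> sets M" "E \<subseteq> F"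
  shows "variation_sup M \<mu> E \<le> variation_sup M \<mu> F"
proof -
  have "variation_sup M \<mu> E \<le> variation_sup M \<mu> E + variation_sup M \<mu> (F - E)"
    by simp
  also have "\<dots> \<le> variation_sup M \<mu> (E \<union> (F - E))"
    by (rule variation_sup_superadditive) (use assms in auto)
  also have "E \<union> (F - E) = F" using assms by blast
  finally show ?thesis .
qed

lemma ennreal_suminf_swap:
  fixes f :: "nat \<Rightarrow> nat \<Rightarrow> ennreal"
  shows "(\<Sum>i. \<Sum>j. f i j) = (\<Sum>j. \<Sum>i. f i j)"
proof -
  have "(\<Sum>j. \<Sum>i. f i j) = (\<integral>\<^sup>+j. (\<Sum>i. f i j) \<partial>count_space UNIV)"
    by (simp add: nn_integral_count_space_nat)
  also have "\<dots> = (\<Sum>i. \<integral>\<^sup>+j. f i j \<partial>count_space UNIV)"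
    by (rule nn_integral_suminf) simp
  finally show ?thesis by (simp add: nn_integral_count_space_nat)
qed

lemma variation_sup_countably_additive:
  assumes cm: "complex_measure M \<mu>"
  shows "countably_additive (sets M) (variation_sup M \<mu>)"
proof (rule countably_additiveI)
  fix E :: "nat \<Rightarrow> 'a set"
  assume E: "range E \<subseteq> sets M" and disj: "disjoint_family E" and U: "\<Union>(range E) \<in> sets M"
  have Ei: "E i \<in> sets M" for i using E by auto
  have "(\<Sum>i<n. variation_sup M \<mu> (E i)) \<le> variation_sup M \<mu> (\<Union>i<n. E i)" for n
  proof (induction n)
    case 0 then show ?case by simp
  next
    case (Suc n)
    have "(\<Union>i<n. E i) \<inter> E n = {}"
    proof -
      have "E i \<inter> E n = {}" if "i < n" for i
        using disj that by (auto simp: disjoint_family_on_def)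
      then show ?thesis by blast
    qed
    then have "variation_sup M \<mu> (\<Union>i<n. E i) + variation_sup M \<mu> (E n)
        \<le> variation_sup M \<mu> ((\<Union>i<n. E i) \<union> E n)"
      by (intro variation_sup_superadditive[OF cm]) (use Ei in auto)
    also have "(\<Union>i<n. E i) \<union> E n = (\<Union>i<Suc n. E i)"
      by (auto simp: lessThan_Suc)
    finally show ?case
      using add_right_mono[OF Suc, of "variation_sup M \<mu> (E n)"]
      by (simp only: sum.lessThan_Suc)
  qed
  moreover have "variation_sup M \<mu> (\<Union>i<n. E i) \<le> variation_sup M \<mu> (\<Union>(range E))" for n
    by (intro variation_sup_mono[OF cm]) (use Ei U in auto)
  ultimately have "(\<Sum>i<n. variation_sup M \<mu> (E i)) \<le> variation_sup M \<mu> (\<Union>(range E))" for n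
    by (rule order_trans)
  then have le: "(\<Sum>i. variation_sup M \<mu> (E i)) \<le> variation_sup M \<mu> (\<Union>(range E))"
    by (intro suminf_le_const) auto
  have ge: "variation_sup M \<mu> (\<Union>(range E)) \<le> (\<Sum>i. variation_sup M \<mu> (E i))"
    unfolding variation_sup_def[of M \<mu> "\<Union>(range E)"]
  proof (rule SUP_least)
    fix A assume A: "A \<in> countable_partitions M (\<Union>(range E))"
    from A have A_sets: "range A \<subseteq> sets M" and A_disj: "disjoint_family A"
      and A_Un: "(\<Union>j. A j) = \<Union>(range E)"
      by (simp_all add: countable_partitions_def)
    have Aj: "A j \<in> sets M" for j using A_sets by blast
    have "ennreal (cmod (\<mu> (A j))) \<le> (\<Sum>i. ennreal (cmod (\<mu> (A j \<inter> E i))))" for j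
    proof (cases "summable (\<lambda>i. cmod (\<mu> (A j \<inter> E i)))")
      case True
      have "(\<Union>i. A j \<inter> E i) = A j"
        using A_Un by blast
      moreover have "(\<lambda>i. \<mu> (A j \<inter> E i)) sums \<mu> (\<Union>i. A j \<inter> E i)"
      proof -
        have "range (\<lambda>i. A j \<inter> E i) \<subseteq> sets M" using sets.Int[OF Aj Ei] by blast
        moreover have "disjoint_family (\<lambda>i. A j \<inter> E i)"
          using disj unfolding disjoint_family_on_def by blast
        ultimately show ?thesis
          by (rule cm[unfolded complex_measure_def, rule_format])
      qed
      ultimately have "\<mu> (A j) = (\<Sum>i. \<mu> (A j \<inter> E i))"
        using sums_unique by metis
      then have "cmod (\<mu> (A j)) \<le> (\<Sum>i. cmod (\<mu> (A j \<inter> E i)))"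
        using summable_norm[OF True] by simp
      then have "ennreal (cmod (\<mu> (A j))) \<le> ennreal (\<Sum>i. cmod (\<mu> (A j \<inter> E i)))"
        by (rule ennreal_leI)
      also have "\<dots> = (\<Sum>i. ennreal (cmod (\<mu> (A j \<inter> E i))))"
        by (rule suminf_ennreal2[symmetric]) (use True in auto)
      finally show ?thesis .
    next
      case False
      then have "(\<Sum>i. ennreal (cmod (\<mu> (A j \<inter> E i)))) = top"
        using summable_suminf_not_top[of "\<lambda>i. cmod (\<mu> (A j \<inter> E i))", OF norm_ge_zero] by blast
      then show ?thesis by simp
    qed
    then have "(\<Sum>j. ennreal (cmod (\<mu> (A j)))) \<le> (\<Sum>j. \<Sum>i. ennreal (cmod (\<mu> (A j \<inter> E i))))"
      by (rule suminf_le[OF _ summableI summableI])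
    also have "\<dots> = (\<Sum>i. \<Sum>j. ennreal (cmod (\<mu> (A j \<inter> E i))))"
      by (rule ennreal_suminf_swap)
    also have "\<dots> \<le> (\<Sum>i. variation_sup M \<mu> (E i))"
    proof (rule suminf_le[OF _ summableI summableI])
      fix i
      have "(\<lambda>j. A j \<inter> E i) \<in> countable_partitions M (E i)"
        unfolding countable_partitions_def mem_Collect_eq
      proof (intro conjI)
        show "range (\<lambda>j. A j \<inter> E i) \<subseteq> sets M" using sets.Int[OF Aj Ei] by blast
        show "disjoint_family (\<lambda>j. A j \<inter> E i)"
          using A_disj unfolding disjoint_family_on_def by blast
        show "(\<Union>j. A j \<inter> E i) = E i" using A_Un by blast
      qed
      then show "(\<Sum>j. ennreal (cmod (\<mu> (A j \<inter> E i)))) \<le> variation_sup M \<mu> (E i)"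
        unfolding variation_sup_def by (rule SUP_upper)
    qed
    finally show "(\<Sum>j. ennreal (cmod (\<mu> (A j)))) \<le> (\<Sum>i. variation_sup M \<mu> (E i))" .
  qed
  show "(\<Sum>i. variation_sup M \<mu> (E i)) = variation_sup M \<mu> (\<Union>(range E))"
    using le ge by (rule antisym)
qed

lemma variation_sup_empty:
  assumes "complex_measure M \<mu>"
  shows "variation_sup M \<mu> {} = 0"
proof -
  have "(\<Sum>i. ennreal (cmod (\<mu> (A i)))) \<le> 0" if "A \<in> countable_partitions M {}" for A
  proof -
    have "A i = {}" for i using that by (auto simp: countable_partitions_def)
    then show ?thesis by (simp add: complex_measure_empty[OF assms])
  qed
  then have "variation_sup M \<mu> {} \<le> 0"
    unfolding variation_sup_def by (rule SUP_least)
  then show ?thesis by simp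
qed

theorem emeasure_total_variation:
  assumes "complex_measure M \<mu>" "E \<in> sets M"
  shows "emeasure (total_variation M \<mu>) E =
    (SUP A\<in>countable_partitions M E. \<Sum>i. ennreal (cmod (\<mu> (A i))))"
proof -
  have "total_variation M \<mu> = measure_of (space M) (sets M) (variation_sup M \<mu>)"
    by (simp add: total_variation_def variation_sup_def[abs_def])
  then have "emeasure (total_variation M \<mu>) E = variation_sup M \<mu> E"
    using assms variation_sup_countably_additive[OF assms(1)] variation_sup_empty[OF assms(1)]
    by (intro emeasure_measure_of[of _ "space M" "sets M"])
       (auto simp: positive_def dest: sets.sets_into_space)
  then show ?thesis by (simp add: variation_sup_def)
qed

lemma norm_le_total_variation:
  assumes "complex_measure M \<mu>" "E \<in> sets M"
  shows "ennreal (cmod (\<mu> E)) \<le> emeasure (total_variation M \<mu>) E"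
  using norm_le_variation_sup[OF assms] by (simp add: emeasure_total_variation[OF assms] variation_sup_def)

lemma real_density_exists:
  fixes r :: "'a set \<Rightarrow> real"
  assumes fin: "finite_measure V"
    and add: "\<And>A :: nat \<Rightarrow> 'a set. range A \<subseteq> sets V \<Longrightarrow> disjoint_family A \<Longrightarrow>
      (\<lambda>i. r (A i)) sums r (\<Union>i. A i)"
    and bound: "\<And>E. E \<in> sets V \<Longrightarrow> \<bar>r E\<bar> \<le> measure V E"
  shows "\<exists>g. integrable V g \<and> (\<forall>E\<in>sets V. r E = (LINT x:E|V. (g x :: real)))"
proof -
  interpret V: finite_measure V by (rule fin)
  define n where "n = (\<lambda>E. ennreal (r E + measure V E))"
  define N where "N = measure_of (space V) (sets V) n"
  have nonneg: "0 \<le> r E + measure V E" if "E \<in> sets V" for E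
    using bound[OF that] by linarith
  have [simp]: "sets N = sets V" "space N = space V" by (auto simp: N_def)
  have "countably_additive (sets V) n"
  proof (rule countably_additiveI)
    fix A :: "nat \<Rightarrow> 'a set"
    assume A: "range A \<subseteq> sets V" "disjoint_family A"
    have "(\<lambda>i. r (A i) + measure V (A i)) sums (r (\<Union>i. A i) + measure V (\<Union>i. A i))"
      using A by (intro sums_add add V.finite_measure_UNION)
    then show "(\<Sum>i. n (A i)) = n (\<Union>(range A))"
      unfolding n_def by (intro suminf_ennreal_eq nonneg) (use A in auto)
  qed
  moreover have "n {} = 0" using bound[of "{}"] by (simp add: n_def)
  ultimately have N: "emeasure N E = n E" if "E \<in> sets V" for E
    using that by (intro emeasure_measure_of[OF N_def]) (auto simp: positive_def dest: sets.sets_into_space)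
  have "absolutely_continuous V N"
    unfolding absolutely_continuous_def
  proof
    fix E assume "E \<in> null_sets V"
    then have E: "E \<in> sets V" "measure V E = 0" by (auto simp: measure_def null_setsD1)
    then have "emeasure N E = 0" using N[of E] bound[of E] by (simp add: n_def)
    then show "E \<in> null_sets N" using E by auto
  qed
  moreover have "finite_measure N"
    by (rule finite_measureI) (simp add: N n_def)
  ultimately obtain f where f [measurable]: "f \<in> borel_measurable V" and fN: "density V f = N"
    using V.Radon_Nikodym_finite_measure[of N] by auto
  have fE: "(\<integral>\<^sup>+x\<in>E. f x \<partial>V) = n E" if "E \<in> sets V" for E
    using N[OF that] emeasure_density[OF f that] fN by simp
  have "(\<integral>\<^sup>+x. f x \<partial>V) \<noteq> \<infinity>"
    using fE[of "space V"] by (simp add: n_def nn_integral_cong[of V "\<lambda>x. f x * indicator (space V) x" f])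
  then have fin_ae: "AE x in V. f x \<noteq> \<infinity>" by (intro nn_integral_PInf_AE) auto
  define g where "g = (\<lambda>x. enn2real (f x))"
  have g_meas [measurable]: "g \<in> borel_measurable V" by (simp add: g_def)
  have gE: "(\<integral>\<^sup>+x. ennreal (g x * indicator E x) \<partial>V) = n E" if "E \<in> sets V" for E
  proof -
    have "(\<integral>\<^sup>+x. ennreal (g x * indicator E x) \<partial>V) = (\<integral>\<^sup>+x\<in>E. f x \<partial>V)"
      using fin_ae by (intro nn_integral_cong_AE) (auto simp: g_def indicator_def top.not_eq_extremum)
    then show ?thesis using fE[OF that] by simp
  qed
  have g_int: "has_bochner_integral V (\<lambda>x. g x * indicator E x) (r E + measure V E)"
    if E: "E \<in> sets V" for E
    using gE[OF E] nonneg[OF E] E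
    by (intro has_bochner_integral_nn_integral) (auto simp: g_def n_def)
  have gi: "integrable V g"
  proof -
    have "integrable V (\<lambda>x. g x * indicator (space V) x)"
      using g_int[of "space V"] by (auto simp: has_bochner_integral_iff)
    then show ?thesis
      by (simp cong: Bochner_Integration.integrable_cong)
  qed
  have "r E = (LINT x:E|V. g x - 1)" if E: "E \<in> sets V" for E
  proof -
    have "(LINT x:E|V. g x - 1) = (LINT x:E|V. g x) - (LINT x:E|V. 1)"
    proof -
      have "integrable V (\<lambda>x. g x * indicator E x)"
        using g_int[OF E] by (simp add: has_bochner_integral_iff)
      moreover have "integrable V (indicator E :: _ \<Rightarrow> real)"
        using E by (intro integrable_real_indicator) (auto simp: V.emeasure_eq_measure)
      ultimately show ?thesis
        unfolding set_lebesgue_integral_def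
        by (subst Bochner_Integration.integral_diff[symmetric]) (auto simp: algebra_simps)
    qed
    also have "(LINT x:E|V. g x) = r E + measure V E"
      using g_int[OF E] by (simp add: set_lebesgue_integral_def has_bochner_integral_iff mult.commute)
    also have "(LINT x:E|V. 1) = measure V E"
      using E by (simp add: set_lebesgue_integral_def)
    finally show ?thesis by simp
  qed
  moreover have "integrable V (\<lambda>x. g x - 1)" using gi by simp
  ultimately show ?thesis by blast
qed

theorem polar_density_density:
  assumes cm: "complex_measure M \<mu>"
    and fin: "emeasure (total_variation M \<mu>) (space M) < \<infinity>"
  shows "integrable (total_variation M \<mu>) (polar_density M \<mu>)"
    and "\<And>E. E \<in> sets M \<Longrightarrow> \<mu> E = (LINT x:E|total_variation M \<mu>. polar_density M \<mu> x)"
proof -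
  let ?V = "total_variation M \<mu>"
  interpret V: finite_measure ?V
    by (rule finite_measureI) (use fin in auto)
  have le: "cmod (\<mu> E) \<le> measure ?V E" if "E \<in> sets M" for E
    using norm_le_total_variation[OF cm that] by (simp add: V.emeasure_eq_measure)
  have sums: "(\<lambda>i. \<mu> (A i)) sums \<mu> (\<Union>i. A i)"
    if "range A \<subseteq> sets ?V" "disjoint_family A" for A :: "nat \<Rightarrow> 'a set"
    using cm that by (simp add: complex_measure_def)
  obtain u where u: "integrable ?V u" "\<And>E. E \<in> sets M \<Longrightarrow> Re (\<mu> E) = (LINT x:E|?V. u x)"
    using real_density_exists[OF V.finite_measure_axioms, of "\<lambda>E. Re (\<mu> E)"]
      sums_Re[OF sums] le order_trans[OF abs_Re_le_cmod] by auto
  obtain v where v: "integrable ?V v" "\<And>E. E \<in> sets M \<Longrightarrow> Im (\<mu> E) = (LINT x:E|?V. v x)"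
    using real_density_exists[OF V.finite_measure_axioms, of "\<lambda>E. Im (\<mu> E)"]
      sums_Im[OF sums] le order_trans[OF abs_Im_le_cmod] by auto
  define h where "h = (\<lambda>x. complex_of_real (u x) + \<i> * complex_of_real (v x))"
  have combine: "(\<integral>x. complex_of_real (a x) + \<i> * complex_of_real (b x) \<partial>?V)
      = complex_of_real (\<integral>x. a x \<partial>?V) + \<i> * complex_of_real (\<integral>x. b x \<partial>?V)"
    if "integrable ?V a" "integrable ?V b" for a b
    using that by (subst Bochner_Integration.integral_add) auto
  have "\<mu> E = (LINT x:E|?V. h x)" if E: "E \<in> sets M" for E
  proof -
    have iu: "integrable ?V (\<lambda>x. indicator E x *\<^sub>R u x)" and iv: "integrable ?V (\<lambda>x. indicator E x *\<^sub>R v x)"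
      using u v E by (auto intro!: integrable_mult_indicator simp del: real_scaleR_def)
    have "(LINT x:E|?V. h x) = (\<integral>x. complex_of_real (indicator E x *\<^sub>R u x)
        + \<i> * complex_of_real (indicator E x *\<^sub>R v x) \<partial>?V)"
      unfolding set_lebesgue_integral_def h_def
      by (intro Bochner_Integration.integral_cong) (auto simp: indicator_def)
    also have "\<dots> = complex_of_real (Re (\<mu> E)) + \<i> * complex_of_real (Im (\<mu> E))"
      using iu iv u(2)[OF E] v(2)[OF E]
      by (simp only: combine[OF iu iv]) (simp add: set_lebesgue_integral_def)
    finally show ?thesis by (simp add: complex_eq[symmetric])
  qed
  moreover have "integrable ?V h" using u v by (simp add: h_def)
  ultimately have "integrable ?V h \<and> (\<forall>E\<in>sets M. \<mu> E = (LINT x:E|?V. h x))" by blast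
  from someI[of "\<lambda>h. integrable ?V h \<and> (\<forall>E\<in>sets M. \<mu> E = (LINT x:E|?V. h x))", OF this]
  show "integrable ?V (polar_density M \<mu>)"
    "\<And>E. E \<in> sets M \<Longrightarrow> \<mu> E = (LINT x:E|?V. polar_density M \<mu> x)"
    by (auto simp: polar_density_def)
qed

end

theory Submission
  imports Defs "HOL-Probability.Probability" "HOL-Complex_Analysis.Complex_Analysis"
begin

text \<open>
  Part (a) reduces to one dimension by treating one coordinate at a time. There, let \<open>f\<close> be the
  transform and \<open>f\<^sub>k\<close> the transform of the part of \<open>\<mu>\<close> with \<open>\<bar>x\<bar> < A\<^sub>k\<close>, where \<open>\<psi> A\<^sub>k \<ge> 2\<^sup>k\<close>; then
  \<open>f - f\<^sub>k\<close> is \<open>O(exp (- 2\<^sup>k))\<close>. By a Remez-type inequality, if \<open>f\<^sub>k\<close> is of this size on a set that fills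
  a fixed proportion of an interval of length \<open>d\<close>, a small multiple of \<open>2\<^sup>k / A\<^sub>k\<close>, then \<open>f\<^sub>k\<close> is
  \<open>O(exp (- 2\<^sup>k / 2))\<close> on an interval extending a distance \<open>d\<close> beyond it, where therefore
  \<open>f\<^bsub>k-1\<^esub>\<close> is \<open>O(exp (- 2\<^bsup>k-1\<^esup>))\<close>. Descending from a large \<open>k\<close> to a fixed one, the interval on which
  the transform is small grows by the partial sums of \<open>\<Sum> 2\<^sup>k / A\<^sub>k\<close>, which diverges together with \<open>I\<close>;
  hence \<open>f\<close> vanishes identically.

  For part (b), \<open>\<mu>\<close> is carried by a coordinate axis, with a density that extends to a bounded
  analytic function in the upper half-plane, so that its transform vanishes on a half-line.
\<close>

section \<open>Interpolation of exponentials at separated points\<close>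

text \<open>A transform as in part (a) need not be analytic: \<psi> may grow like
  \<open>x / ln x\<close>. Zeros cannot be continued by an identity theorem, so smallness is carried
  along quantitatively. An extension step halves the exponent; with doubling levels the halved bound
  is just the size of the error made in passing to the next shorter truncation, so nothing
  accumulates during the descent. As long as the interval gained is shorter than the next step, the
  Remez inequality must use the given set itself. This calls for a point to whose right the set has
  a fixed proportion at all small scales. The extension therefore runs to the right only; the
  half-line it yields, reflected, starts a second run in the other direction. In part (b) \<psi> may
  jump, so it is sampled at the integers; the resulting series converges by an integral test for
  \<open>I\<close>. Its poles have imaginary part -1, so each partial sum is analytic across the
  real axis and Cauchy's theorem applies to it there.\<close>

lemma separated_points:
  fixes T :: "real set"
  assumes "closed T" "bdd_below T" "0 \<le> s" "ennreal (real m * s) < emeasure lborel T"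
  shows "\<exists>x :: nat \<Rightarrow> real. (\<forall>i\<le>m. x i \<in> T) \<and> (\<forall>i<m. x i + s \<le> x (Suc i))"
  using assms
proof (induction m arbitrary: T)
  case 0
  then have "T \<noteq> {}" by auto
  then obtain y where "y \<in> T" by blast
  then show ?case by (intro exI[of _ "\<lambda>_. y"]) auto
next
  case (Suc m)
  have ne: "T \<noteq> {}" using Suc.prems by auto
  define a where "a = Inf T"
  have aT: "a \<in> T" unfolding a_def by (rule closed_contains_Inf[OF ne Suc.prems(2,1)])
  have lo: "a \<le> y" if "y \<in> T" for y
    unfolding a_def by (rule cInf_lower[OF that Suc.prems(2)])
  \<comment> \<open>Greedy choice: the least point is kept and the stretch of length
    \<open>s\<close> after it is discarded, which costs measure at most \<open>s\<close>, the
    difference between the budgets for \<open>Suc m\<close> and \<open>m\<close>.\<close>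
  define T' where "T' = T \<inter> {a + s..}"
  have cl: "closed T'" unfolding T'_def using Suc.prems by (intro closed_Int) auto
  have bd: "bdd_below T'" unfolding T'_def using Suc.prems(2) by (rule bdd_below_mono) auto
  have "emeasure lborel T \<le> emeasure lborel ({a..a+s} \<union> T')"
    by (rule emeasure_mono) (use lo cl in \<open>auto simp: T'_def\<close>)
  also have "\<dots> \<le> emeasure lborel {a..a+s} + emeasure lborel T'"
    by (rule emeasure_subadditive) (use cl in auto)
  finally have le: "emeasure lborel T \<le> ennreal s + emeasure lborel T'"
    using Suc.prems by simp
  have "ennreal (real m * s) < emeasure lborel T'"
  proof (rule ccontr)
    assume "\<not> ?thesis"
    then have "emeasure lborel T \<le> ennreal s + ennreal (real m * s)"
      using le add_left_mono[of "emeasure lborel T'" "ennreal (real m * s)" "ennreal s"] by (auto simp: not_less intro: order_trans)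
    also have "\<dots> = ennreal (real (Suc m) * s)"
      using Suc.prems by (simp add: ennreal_plus[symmetric] algebra_simps del: ennreal_plus)
    finally show False using Suc.prems(4) by simp
  qed
  from Suc.IH[OF cl bd Suc.prems(3) this] obtain x where
    x: "\<And>i. i \<le> m \<Longrightarrow> x i \<in> T'" "\<And>i. i < m \<Longrightarrow> x i + s \<le> x (Suc i)" by blast
  define x' where "x' = case_nat a x"
  have "x' i \<in> T" if "i \<le> Suc m" for i
    using that x aT by (cases i) (auto simp: x'_def T'_def)
  moreover have "x' i + s \<le> x' (Suc i)" if "i < Suc m" for i
    using that x(2) x(1)[of 0] by (cases i) (auto simp: x'_def T'_def)
  ultimately show ?case by blast
qed

lemma separated_gap:
  fixes x :: "nat \<Rightarrow> real"
  assumes "\<And>i. i < m \<Longrightarrow> x i + s \<le> x (Suc i)" "i + k \<le> m"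
  shows "real k * s \<le> x (i + k) - x i"
  using assms(2)
proof (induction k)
  case (Suc k)
  then show ?case using assms(1)[of "i + k"] by (simp add: algebra_simps)
qed simp

text \<open>The difference of the two sides has degree at most \<open>m\<close> and
  \<open>m + 1\<close> distinct roots.\<close>

lemma Lagrange_interpolation:
  fixes x :: "nat \<Rightarrow> 'a::field"
  assumes inj: "inj_on x {..m}" and deg: "degree p \<le> m"
  shows "poly p z = (\<Sum>i\<le>m. poly p (x i) * (\<Prod>j\<in>{..m} - {i}. (z - x j) / (x i - x j)))"
proof -
  define b where "b = (\<lambda>i. \<Prod>j\<in>{..m} - {i}. smult (1 / (x i - x j)) [:- x j, 1:])"
  define q where "q = p - (\<Sum>i\<le>m. smult (poly p (x i)) (b i))"
  have b: "poly (b i) z = (\<Prod>j\<in>{..m} - {i}. (z - x j) / (x i - x j))" for i z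
    by (simp add: b_def poly_prod diff_divide_distrib)
  have degb: "degree (b i) \<le> m" if "i \<le> m" for i
  proof -
    have "degree (b i) \<le> sum (degree \<circ> (\<lambda>j. smult (1 / (x i - x j)) [:- x j, 1:])) ({..m} - {i})"
      unfolding b_def by (rule degree_prod_sum_le) simp
    also have "\<dots> \<le> (\<Sum>j\<in>{..m} - {i}. 1)" by (rule sum_mono) auto
    also have "\<dots> = m" using that by simp
    finally show ?thesis .
  qed
  have bx: "poly (b i) (x k) = (if i = k then 1 else 0)" if "i \<le> m" "k \<le> m" for i k
  proof (cases "i = k")
    case True
    have "x k \<noteq> x j" if "j \<in> {..m} - {k}" for j
      using inj \<open>k \<le> m\<close> that by (auto dest: inj_onD)
    then show ?thesis using True by (simp add: b)
  next
    case False
    then show ?thesis using that by (auto simp: b intro!: prod_zero)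
  qed
  have "q = 0"
  proof (rule ccontr)
    assume q0: "q \<noteq> 0"
    have "poly q (x k) = 0" if "k \<le> m" for k
    proof -
      have "(\<Sum>i\<le>m. poly p (x i) * poly (b i) (x k)) = (\<Sum>i\<le>m. if i = k then poly p (x i) else 0)"
        using that by (intro sum.cong) (auto simp: bx)
      then show ?thesis using that by (simp add: q_def poly_sum)
    qed
    then have "x ` {..m} \<subseteq> {z. poly q z = 0}" by auto
    then have "card (x ` {..m}) \<le> card {z. poly q z = 0}"
      by (rule card_mono[OF poly_roots_finite[OF q0]])
    also have "\<dots> \<le> degree q" by (rule card_poly_roots_bound[OF q0])
    also have "\<dots> \<le> m"
      unfolding q_def using deg degb
      by (intro degree_diff_le degree_sum_le) (auto intro: order_trans[OF degree_smult_le])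
    finally show False using inj by (simp add: card_image)
  qed
  then have "p = (\<Sum>i\<le>m. smult (poly p (x i)) (b i))" by (simp add: q_def)
  then have "poly p z = poly (\<Sum>i\<le>m. smult (poly p (x i)) (b i)) z" by (rule arg_cong)
  then show ?thesis by (simp add: poly_sum b)
qed

text \<open>The \<open>i\<close>-th fundamental Lagrange polynomial for the nodes
  \<open>x 0, ..., x m\<close>, evaluated at \<open>y\<close>. The sum of the absolute values over
  \<open>i\<close> is the Lebesgue function of the nodes.\<close>

definition lagrange_weight :: "nat \<Rightarrow> (nat \<Rightarrow> real) \<Rightarrow> real \<Rightarrow> nat \<Rightarrow> real" where
  "lagrange_weight m x y i = (\<Prod>j\<in>{..m} - {i}. (y - x j) / (x i - x j))"

text \<open>Equally spaced nodes are the worst case: the distance from \<open>x i\<close> to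
  \<open>x j\<close> is at least \<open>s\<close> times the difference of the indices, and these
  differences multiply to \<open>fact i\<close> on the left of \<open>i\<close> and to
  \<open>fact (m - i)\<close> on the right.\<close>

lemma prod_separated_ge:
  fixes x :: "nat \<Rightarrow> real"
  assumes sep: "\<And>i. i < m \<Longrightarrow> x i + s \<le> x (Suc i)" and s: "0 \<le> s" and i: "i \<le> m"
  shows "s ^ m * (fact i * fact (m - i)) \<le> (\<Prod>j\<in>{..m} - {i}. \<bar>x i - x j\<bar>)"
proof -
  have split: "{..m} - {i} = {..<i} \<union> {Suc i..m}" using i by auto
  have A: "(\<Prod>j<i. real (i - j) * s) \<le> (\<Prod>j<i. \<bar>x i - x j\<bar>)"
  proof (rule prod_mono, safe)
    fix j assume j: "j < i"
    then show "real (i - j) * s \<le> \<bar>x i - x j\<bar>"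
      using separated_gap[of m x s, OF sep, of j "i - j"] i by auto
  qed (use s in auto)
  have B: "(\<Prod>j\<in>{Suc i..m}. real (j - i) * s) \<le> (\<Prod>j\<in>{Suc i..m}. \<bar>x i - x j\<bar>)"
  proof (rule prod_mono, safe)
    fix j assume j: "j \<in> {Suc i..m}"
    then show "real (j - i) * s \<le> \<bar>x i - x j\<bar>"
      using separated_gap[of m x s, OF sep, of i "j - i"] by auto
  qed (use s in auto)
  have a: "(\<Prod>j<i. real (i - j)) = fact i"
    unfolding fact_prod_rev by (simp add: atLeast0LessThan)
  have b: "(\<Prod>j\<in>{Suc i..m}. real (j - i)) = fact (m - i)"
  proof -
    have "(\<Prod>j\<in>{Suc i..m}. real (j - i)) = (\<Prod>j\<in>{1..m - i}. real j)"
      by (rule prod.reindex_bij_witness[of _ "\<lambda>j. j + i" "\<lambda>j. j - i"]) (use i in auto)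
    then show ?thesis by (simp add: fact_prod)
  qed
  have "s ^ m = s ^ i * s ^ (m - i)" using i by (simp flip: power_add)
  then have "s ^ m * (fact i * fact (m - i))
      = (\<Prod>j<i. real (i - j) * s) * (\<Prod>j\<in>{Suc i..m}. real (j - i) * s)"
    unfolding prod.distrib a b by simp
  also have "\<dots> \<le> (\<Prod>j<i. \<bar>x i - x j\<bar>) * (\<Prod>j\<in>{Suc i..m}. \<bar>x i - x j\<bar>)"
    using s by (intro mult_mono A B) (auto intro!: prod_nonneg mult_nonneg_nonneg)
  also have "\<dots> = (\<Prod>j\<in>{..m} - {i}. \<bar>x i - x j\<bar>)"
    unfolding split by (rule prod.union_disjoint[symmetric]) auto
  finally show ?thesis .
qed

text \<open>Each weight is at most \<open>(D / s) ^ m / fact m\<close> times a binomial coefficient,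
  and those sum to \<open>2 ^ m\<close>. The factorial is essential: when \<open>D / s\<close> is of
  order \<open>m\<close>, the bound becomes a pure power \<open>C ^ m\<close>.\<close>

lemma lebesgue_constant_le:
  fixes x :: "nat \<Rightarrow> real"
  assumes sep: "\<And>i. i < m \<Longrightarrow> x i + s \<le> x (Suc i)" and s: "0 < s"
    and D: "\<And>i. i \<le> m \<Longrightarrow> \<bar>y - x i\<bar> \<le> D"
  shows "(\<Sum>i\<le>m. \<bar>lagrange_weight m x y i\<bar>) \<le> (2 * D / s) ^ m / fact m"
proof -
  have "\<bar>lagrange_weight m x y i\<bar> \<le> (D / s) ^ m / fact m * real (m choose i)" if i: "i \<le> m" for i
  proof -
    have "\<bar>lagrange_weight m x y i\<bar> = (\<Prod>j\<in>{..m} - {i}. \<bar>y - x j\<bar>) / (\<Prod>j\<in>{..m} - {i}. \<bar>x i - x j\<bar>)"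
      by (simp add: lagrange_weight_def abs_prod prod_dividef)
    also have "\<dots> \<le> D ^ m / (s ^ m * (fact i * fact (m - i)))"
    proof (rule frac_le)
      have "(\<Prod>j\<in>{..m} - {i}. \<bar>y - x j\<bar>) \<le> (\<Prod>j\<in>{..m} - {i}. D)"
        using D by (intro prod_mono) auto
      then show "(\<Prod>j\<in>{..m} - {i}. \<bar>y - x j\<bar>) \<le> D ^ m" using i by simp
      show "0 \<le> D ^ m" using D[OF i] by auto
    qed (use s prod_separated_ge[of m x s i] sep i in auto)
    also have "\<dots> = (D / s) ^ m / fact m * real (m choose i)"
      using i s by (simp add: binomial_fact power_divide)
    finally show ?thesis .
  qed
  then have "(\<Sum>i\<le>m. \<bar>lagrange_weight m x y i\<bar>) \<le> (\<Sum>i\<le>m. (D / s) ^ m / fact m * real (m choose i))"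
    by (intro sum_mono) auto
  also have "\<dots> = (D / s) ^ m / fact m * real (\<Sum>i\<le>m. m choose i)"
    by (simp only: sum_distrib_left of_nat_sum)
  also have "\<dots> = (2 * D / s) ^ m / fact m"
    by (simp add: choose_row_sum power_divide power_mult_distrib)
  finally show ?thesis .
qed

text \<open>Interpolation reproduces the Taylor polynomial \<open>p\<close> of degree
  \<open>m\<close> at \<open>u\<close> exactly. So only the Taylor remainder \<open>R\<close>
  contributes, once at \<open>y\<close> and once at each node, where it is multiplied by the
  weight.\<close>

lemma exp_interpolation_error:
  fixes x :: "nat \<Rightarrow> real"
  assumes inj: "inj_on x {..m}" and t: "\<bar>t\<bar> \<le> A"
    and y: "\<bar>y - u\<bar> \<le> D" and x: "\<And>i. i \<le> m \<Longrightarrow> \<bar>x i - u\<bar> \<le> D"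
  shows "cmod (iexp (y * t) - (\<Sum>i\<le>m. lagrange_weight m x y i * iexp (x i * t)))
     \<le> (1 + (\<Sum>i\<le>m. \<bar>lagrange_weight m x y i\<bar>)) * ((D * A) ^ Suc m / fact (Suc m))"
proof -
  define p :: "complex poly" where
    "p = (\<Sum>k\<le>m. smult (iexp (u * t) * (\<i> * t) ^ k / fact k) ([:- of_real u, 1:] ^ k))"
  have deg: "degree p \<le> m"
    unfolding p_def
  proof (intro degree_sum_le)
    fix k assume "k \<in> {..m}"
    then show "degree (smult (iexp (u * t) * (\<i> * t) ^ k / fact k) ([:- of_real u, 1:] ^ k)) \<le> m"
      using degree_power_le[of "[:- of_real u, 1:] :: complex poly" k]
      by (intro order_trans[OF degree_smult_le]) auto
  qed simp
  define R where "R = (D * A) ^ Suc m / fact (Suc m)"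
  have R: "cmod (iexp (z * t) - poly p (of_real z)) \<le> R" if z: "\<bar>z - u\<bar> \<le> D" for z :: real
  proof -
    have "iexp (z * t) = iexp (u * t) * iexp ((z - u) * t)"
      by (simp add: exp_add[symmetric] algebra_simps)
    moreover have "poly p (of_real z) = iexp (u * t) * (\<Sum>k\<le>m. (\<i> * ((z - u) * t)) ^ k / fact k)"
      unfolding p_def poly_sum sum_distrib_left
      by (intro sum.cong) (simp_all add: poly_power power_mult_distrib mult_ac)
    ultimately have "iexp (z * t) - poly p (of_real z)
        = iexp (u * t) * (iexp ((z - u) * t) - (\<Sum>k\<le>m. (\<i> * ((z - u) * t)) ^ k / fact k))"
      by (simp add: algebra_simps)
    then have "cmod (iexp (z * t) - poly p (of_real z))
        = cmod (iexp ((z - u) * t) - (\<Sum>k\<le>m. (\<i> * ((z - u) * t)) ^ k / fact k))"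
      by (simp add: norm_mult)
    also have "\<dots> \<le> \<bar>(z - u) * t\<bar> ^ Suc m / fact (Suc m)"
      using iexp_approx1[of "(z - u) * t" m] by simp
    also have "\<dots> \<le> R"
      unfolding R_def abs_mult
      using z t by (intro divide_right_mono power_mono mult_mono) auto
    finally show ?thesis .
  qed
  have inj': "inj_on (\<lambda>i. complex_of_real (x i)) {..m}"
    using inj by (auto simp: inj_on_def)
  have P: "poly p (of_real y) = (\<Sum>i\<le>m. lagrange_weight m x y i * poly p (x i))"
    by (subst Lagrange_interpolation[OF inj' deg]) (simp add: lagrange_weight_def mult.commute)
  let ?W = "\<Sum>i\<le>m. \<bar>lagrange_weight m x y i\<bar>"
  have "iexp (y * t) - (\<Sum>i\<le>m. lagrange_weight m x y i * iexp (x i * t))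
      = (iexp (y * t) - poly p (of_real y))
        - (\<Sum>i\<le>m. lagrange_weight m x y i * (iexp (x i * t) - poly p (x i)))"
    unfolding P by (simp add: sum_subtractf algebra_simps)
  also have "cmod \<dots> \<le> R + (\<Sum>i\<le>m. cmod (lagrange_weight m x y i * (iexp (x i * t) - poly p (x i))))"
    by (intro order_trans[OF norm_triangle_ineq4] add_mono R[OF y] norm_sum)
  also have "\<dots> \<le> R + (\<Sum>i\<le>m. \<bar>lagrange_weight m x y i\<bar> * R)"
    using R x by (intro add_left_mono sum_mono) (auto simp: norm_mult intro!: mult_left_mono)
  also have "\<dots> = (1 + ?W) * R" by (simp only: sum_distrib_right[symmetric] distrib_right mult_1_left)
  finally show ?thesis unfolding R_def .
qed

section \<open>The Remez-type estimate\<close>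

lemma power_div_fact_le_exp: "(0::real) \<le> x \<Longrightarrow> x ^ n / fact n \<le> exp x"
proof -
  assume x: "0 \<le> x"
  have "(\<Sum>k\<in>{n}. x ^ k / fact k) \<le> (\<Sum>k. x ^ k / fact k)"
    using x summable_exp_generic[of x] by (intro sum_le_suminf) (auto simp: scaleR_conv_of_real field_simps)
  then show ?thesis by (simp add: exp_def scaleR_conv_of_real field_simps)
qed

text \<open>Integrating a pointwise approximation of one exponential by others against
  \<open>h\<close> gives the same approximation between transforms. The setting is an arbitrary
  measure space because \<open>X\<close> will be one coordinate of a vector, with the other
  coordinates hidden in \<open>h\<close>.\<close>

lemma integral_combination_bound:
  fixes h :: "'a \<Rightarrow> complex" and X :: "'a \<Rightarrow> real" and w :: "nat \<Rightarrow> real"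
  assumes h: "integrable M h" and X [measurable]: "X \<in> borel_measurable M"
    and supp: "\<And>t. t \<in> space M \<Longrightarrow> h t \<noteq> 0 \<Longrightarrow> \<bar>X t\<bar> \<le> A"
    and err: "\<And>t. \<bar>t\<bar> \<le> A \<Longrightarrow> cmod (iexp (y * t) - (\<Sum>i\<le>m. w i * iexp (x i * t))) \<le> R"
    and small: "\<And>i. i \<le> m \<Longrightarrow> cmod (\<integral>t. iexp (x i * X t) * h t \<partial>M) \<le> e"
  shows "cmod (\<integral>t. iexp (y * X t) * h t \<partial>M)
     \<le> (\<Sum>i\<le>m. \<bar>w i\<bar>) * e + R * (\<integral>t. cmod (h t) \<partial>M)"
proof -
  have [measurable]: "h \<in> borel_measurable M" using h by auto
  have int: "integrable M (\<lambda>t. iexp (z * X t) * h t)" for z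
    by (rule Bochner_Integration.integrable_bound[OF integrable_norm[OF h]]) (auto simp: norm_mult)
  have intS: "integrable M (\<lambda>t. (\<Sum>i\<le>m. w i * (iexp (x i * X t) * h t)))"
    by (intro Bochner_Integration.integrable_sum integrable_mult_right int)
  have "(\<integral>t. iexp (y * X t) * h t \<partial>M) - (\<Sum>i\<le>m. w i * (\<integral>t. iexp (x i * X t) * h t \<partial>M))
     = (\<integral>t. iexp (y * X t) * h t - (\<Sum>i\<le>m. w i * (iexp (x i * X t) * h t)) \<partial>M)"
    by (subst Bochner_Integration.integral_diff[OF int intS], subst Bochner_Integration.integral_sum)
       (use integrable_mult_right[OF int] in \<open>auto simp: mult.assoc\<close>)
  also have "cmod \<dots> \<le> (\<integral>t. R * cmod (h t) \<partial>M)"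
  proof (rule order_trans[OF integral_norm_bound Bochner_Integration.integral_mono])
    show "integrable M (\<lambda>t. cmod (iexp (y * X t) * h t - (\<Sum>i\<le>m. w i * (iexp (x i * X t) * h t))))"
      by (intro integrable_norm Bochner_Integration.integrable_diff int intS)
    show "integrable M (\<lambda>t. R * cmod (h t))" using h by auto
    fix t assume t: "t \<in> space M"
    have "iexp (y * X t) * h t - (\<Sum>i\<le>m. w i * (iexp (x i * X t) * h t))
        = (iexp (y * X t) - (\<Sum>i\<le>m. w i * iexp (x i * X t))) * h t"
      by (simp only: left_diff_distrib sum_distrib_right mult.assoc)
    then show "cmod (iexp (y * X t) * h t - (\<Sum>i\<le>m. w i * (iexp (x i * X t) * h t))) \<le> R * cmod (h t)"
      using err[OF supp[OF t]] by (cases "h t = 0") (auto simp: norm_mult intro!: mult_right_mono)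
  qed
  finally have 1: "cmod ((\<integral>t. iexp (y * X t) * h t \<partial>M) - (\<Sum>i\<le>m. w i * (\<integral>t. iexp (x i * X t) * h t \<partial>M)))
      \<le> R * (\<integral>t. cmod (h t) \<partial>M)" by simp
  have "cmod (\<Sum>i\<le>m. w i * (\<integral>t. iexp (x i * X t) * h t \<partial>M)) \<le> (\<Sum>i\<le>m. \<bar>w i\<bar> * e)"
    using small by (intro order_trans[OF norm_sum] sum_mono) (auto simp: norm_mult intro!: mult_left_mono)
  then have 2: "cmod (\<Sum>i\<le>m. w i * (\<integral>t. iexp (x i * X t) * h t \<partial>M)) \<le> (\<Sum>i\<le>m. \<bar>w i\<bar>) * e"
    by (simp add: sum_distrib_right)
  show ?thesis using 1 2 norm_triangle_sub[of "\<integral>t. iexp (y * X t) * h t \<partial>M" "\<Sum>i\<le>m. w i * (\<integral>t. iexp (x i * X t) * h t \<partial>M)"]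
    by linarith
qed

text \<open>In terms of \<open>q = exp (- (p / 4))\<close> the summands are of order
  \<open>q ^ 3\<close>, \<open>q ^ 8\<close> and \<open>q ^ 7\<close>, against \<open>q ^ 2\<close>
  on the right; \<open>16 \<le> p\<close> makes \<open>q\<close> at most 1/16, so the spare power of
  \<open>q\<close> absorbs the constants.\<close>

lemma interpolation_constants:
  fixes p :: real
  assumes p: "16 \<le> p"
  shows "exp 1 * exp (p / 4) * (2 * exp (- p)) + (1 + exp 1 * exp (p / 4)) * exp (- (2 * p)) \<le> exp (- (p / 2))"
proof -
  define q where "q = exp (- (p / 4))"
  have e1: "exp (1::real) \<le> 3" by (rule exp_le)
  have "(2::real) ^ 4 \<le> exp 1 ^ 4" using exp_ge_add_one_self[of "1::real"] by (intro power_mono) auto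
  also have "\<dots> = exp 4" by (simp add: exp_of_nat_mult[symmetric])
  also have "\<dots> \<le> exp (p / 4)" using p by simp
  finally have "q \<le> 1 / 16" by (simp add: q_def exp_minus field_simps)
  moreover have q0: "0 < q" by (simp add: q_def)
  ultimately have q1: "q ^ k \<le> q / 16" if "2 \<le> k" for k
  proof -
    have "q ^ k \<le> q ^ 2" using that q0 \<open>q \<le> 1 / 16\<close> by (intro power_decreasing) auto
    also have "\<dots> \<le> q * (1 / 16)" unfolding power2_eq_square using q0 \<open>q \<le> 1 / 16\<close> by (intro mult_left_mono) auto
    finally show ?thesis by simp
  qed
  have pw: "q ^ k = exp (- (real k * p / 4))" for k
    by (simp add: q_def exp_of_nat_mult[symmetric])
  have powers: "q ^ 2 * q = q ^ 3" "q ^ 2 * q ^ 6 = q ^ 8" "q ^ 2 * q ^ 5 = q ^ 7"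
    by (simp_all add: eval_nat_numeral)
  have a: "exp (p / 4) * exp (- p) = q ^ 2 * q" "exp (- (2 * p)) = q ^ 2 * q ^ 6"
     "exp (p / 4) * exp (- (2 * p)) = q ^ 2 * q ^ 5" "exp (- (p / 2)) = q ^ 2"
    unfolding powers unfolding pw by (simp_all add: exp_add[symmetric])
  have "exp 1 * exp (p / 4) * (2 * exp (- p)) + (1 + exp 1 * exp (p / 4)) * exp (- (2 * p))
     = 2 * exp 1 * (exp (p / 4) * exp (- p)) + (exp (- (2 * p)) + exp 1 * (exp (p / 4) * exp (- (2 * p))))"
    by (simp add: algebra_simps)
  also have "\<dots> = q ^ 2 * (2 * exp 1 * q + q ^ 6 + exp 1 * q ^ 5)"
    unfolding a(1,3) unfolding a(2) by (simp add: algebra_simps)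
  also have "\<dots> \<le> q ^ 2 * (6 * q + q / 16 + 3 * (q / 16))"
    using q0 e1 q1[of 6] q1[of 5] by (intro mult_left_mono add_mono mult_mono) auto
  also have "\<dots> \<le> q ^ 2 * 1" using q0 \<open>q \<le> 1 / 16\<close> by (intro mult_left_mono) auto
  finally show ?thesis using a by simp
qed

text \<open>
  A Remez-type inequality: interpolating at \<open>m + 1\<close> well separated points of \<open>T\<close>, with \<open>m\<close> a small
  multiple of \<open>p\<close>, loses only a factor \<open>C\<^sup>m\<close>, while the interpolation error is at most \<open>exp (- 2 * p)\<close>.
\<close>

lemma smallness_propagates:
  fixes c0 :: real
  assumes c0: "0 < c0" "c0 \<le> 1"
  obtains c where "0 < c"
    "\<And>(M :: 'a measure) h X A K p u d T y. integrable M h \<Longrightarrow> X \<in> borel_measurable M \<Longrightarrow>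
       (\<And>t. t \<in> space M \<Longrightarrow> h t \<noteq> 0 \<Longrightarrow> \<bar>X t\<bar> \<le> A) \<Longrightarrow> (\<integral>t. cmod (h t) \<partial>M) \<le> K \<Longrightarrow> 0 < A \<Longrightarrow>
       16 \<le> p \<Longrightarrow> 0 < d \<Longrightarrow> d \<le> c * p / A \<Longrightarrow>
       closed T \<Longrightarrow> T \<subseteq> {u..u + 2 * d} \<Longrightarrow> ennreal (c0 * d) \<le> emeasure lborel T \<Longrightarrow>
       (\<And>z. z \<in> T \<Longrightarrow> cmod (\<integral>t. iexp (z * X t) * h t \<partial>M) \<le> 2 * K * exp (- p)) \<Longrightarrow>
       y \<in> {u..u + 2 * d} \<Longrightarrow> cmod (\<integral>t. iexp (y * X t) * h t \<partial>M) \<le> K * exp (- (p / 2))"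
proof -
  \<comment> \<open>The base of the loss: with spacing \<open>c0 * d / Suc m\<close> and diameter
    \<open>2 * d\<close> the Lebesgue constant is at most \<open>exp 1 * C ^ m\<close>, where
    \<open>4 / c0\<close> comes from the ratio of diameter to spacing and \<open>exp 1\<close> from
    \<open>Suc m ^ m / fact m\<close>.\<close>
  define C where "C = 4 * exp 1 / c0"
  have "4 * 2 \<le> 4 * exp (1::real)" using exp_ge_add_one_self[of "1::real"] by auto
  also have "\<dots> \<le> C" unfolding C_def using c0 by (simp add: field_simps)
  finally have C: "8 \<le> C" by simp
  have lnC: "0 < ln C" using C by simp
  \<comment> \<open>Chosen so that the Taylor remainder of order \<open>n = Suc m\<close> is at most
    \<open>C powr (-8)\<close> to the power \<open>n\<close>; as
    \<open>n * ln C \<ge> p / 4\<close>, this is at most \<open>exp (- (2 * p))\<close>.\<close>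
  define c where "c = C powr (-8) / (8 * exp 1 * ln C)"
  show thesis
  proof (rule that[of c])
    show "0 < c" using C lnC by (simp add: c_def)
    fix M :: "'a measure" and h X A K p u d T y
    assume h: "integrable M h" and X: "X \<in> borel_measurable M"
      and supp: "\<And>t. t \<in> space M \<Longrightarrow> h t \<noteq> 0 \<Longrightarrow> \<bar>X t\<bar> \<le> A"
      and K: "(\<integral>t. cmod (h t) \<partial>M) \<le> K" and A: "0 < A"
      and p: "(16::real) \<le> p" and d: "0 < d" "d \<le> c * p / A"
      and T: "closed T" "T \<subseteq> {u..u + 2 * d}" "ennreal (c0 * d) \<le> emeasure lborel T"
      and small: "\<And>z. z \<in> T \<Longrightarrow> cmod (\<integral>t. iexp (z * X t) * h t \<partial>M) \<le> 2 * K * exp (- p)"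
      and y: "y \<in> {u..u + 2 * d}"
    have K0: "0 \<le> K" by (rule order_trans[OF Bochner_Integration.integral_nonneg K]) auto
    \<comment> \<open>The largest degree with \<open>C ^ m \<le> exp (p / 4)\<close>: the loss then
      uses up only part of the exponent, while the degree is still large enough for the
      remainder.\<close>
    define m where "m = nat \<lfloor>p / (4 * ln C)\<rfloor>"
    have m1: "real m \<le> p / (4 * ln C)" using p lnC by (simp add: m_def)
    have m2: "p / (4 * ln C) \<le> real (Suc m)" unfolding m_def using p lnC by linarith
    \<comment> \<open>Dividing by \<open>Suc m\<close> instead of \<open>m\<close> makes
      \<open>m\<close> gaps fit strictly inside measure \<open>c0 * d\<close> and covers
      \<open>m = 0\<close>.\<close>
    define s where "s = c0 * d / real (Suc m)"
    have s: "0 < s" using c0 d by (simp add: s_def)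
    have "real m * s < c0 * d" using c0 d by (simp add: s_def field_simps)
    then have "ennreal (real m * s) < emeasure lborel T"
      using T(3) c0 d by (intro less_le_trans[OF _ T(3)]) (simp add: ennreal_less_iff s_def)
    moreover have "bdd_below T" using T(2) by (meson bdd_below_Icc bdd_below_mono)
    ultimately obtain x where xT: "\<And>i. i \<le> m \<Longrightarrow> x i \<in> T" and sep: "\<And>i. i < m \<Longrightarrow> x i + s \<le> x (Suc i)"
      using separated_points[of T s m] T(1) s by (auto intro: less_imp_le)
    have inj: "inj_on x {..m}"
    proof (rule linorder_inj_onI')
      fix i j assume ij: "i \<in> {..m}" "j \<in> {..m}" "i < j"
      then have "(real j - real i) * s \<le> x j - x i" using separated_gap[of m x s i "j - i", OF sep] by (auto simp: of_nat_diff)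
      moreover have "0 < (real j - real i) * s" using ij s by auto
      ultimately show "x i \<noteq> x j" by auto
    qed
    let ?L = "\<Sum>i\<le>m. \<bar>lagrange_weight m x y i\<bar>"
    have rng: "u \<le> x i" "x i \<le> u + 2 * d" if "i \<le> m" for i using xT[OF that] T(2) by auto
    have "?L \<le> (2 * (2 * d) / s) ^ m / fact m"
    proof (rule lebesgue_constant_le[of m x s y "2 * d", OF sep s])
      fix i assume "i \<le> m"
      from rng[OF this] y show "\<bar>y - x i\<bar> \<le> 2 * d" by (auto simp: abs_le_iff)
    qed
    also have "2 * (2 * d) / s = 4 / c0 * real (Suc m)" using c0 d by (simp add: s_def field_simps)
    also have "(4 / c0 * real (Suc m)) ^ m / fact m = (4 / c0) ^ m * (real (Suc m) ^ m / fact m)"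
      by (simp only: power_mult_distrib times_divide_eq_right)
    also have "\<dots> \<le> (4 / c0) ^ m * exp (real (Suc m))"
      using c0 by (intro mult_left_mono power_div_fact_le_exp) auto
    also have "exp (real (Suc m)) = exp 1 * exp 1 ^ m"
      by (simp add: exp_of_nat_mult[symmetric] exp_add[symmetric])
    also have "(4 / c0) ^ m * (exp 1 * exp 1 ^ m) = exp 1 * C ^ m"
      by (simp add: C_def power_mult_distrib power_divide)
    also have "C ^ m = exp (ln C * real m)" using C by (simp add: powr_realpow[symmetric] powr_def mult.commute)
    also have "exp (ln C * real m) \<le> exp (p / 4)" using m1 lnC by (simp add: field_simps)
    finally have L: "?L \<le> exp 1 * exp (p / 4)" by simp
    define n where "n = Suc m"
    have n0: "0 < real n" by (simp add: n_def)
    define R where "R = (2 * d * A) ^ n / fact n"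
    have "real n ^ n \<le> fact n * exp 1 ^ n"
      using power_div_fact_le_exp[of "real n" n] by (simp add: exp_of_nat_mult[symmetric] field_simps)
    then have fn: "1 / fact n \<le> exp 1 ^ n / real n ^ n" using n0 by (simp add: field_simps)
    have dA: "2 * d * A \<le> 2 * (c * p)" using d A by (simp add: field_simps)
    have "R \<le> (2 * (c * p)) ^ n * (1 / fact n)"
      unfolding R_def using power_mono[OF dA, of n] d A by (simp add: divide_right_mono del: power_mult_distrib)
    also have "\<dots> \<le> (2 * (c * p)) ^ n * (exp 1 ^ n / real n ^ n)"
      using fn d A dA p \<open>0 < c\<close> by (intro mult_left_mono) auto
    also have "\<dots> = (2 * exp 1 * c * (p / n)) ^ n" by (simp add: power_mult_distrib power_divide)
    also have "\<dots> \<le> (C powr (-8)) ^ n"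
    proof (rule power_mono)
      have "p / n \<le> 4 * ln C" using m2 lnC n0 by (simp add: n_def field_simps)
      then have "2 * exp 1 * c * (p / n) \<le> 2 * exp 1 * c * (4 * ln C)"
        using \<open>0 < c\<close> by (intro mult_left_mono) auto
      also have "\<dots> = C powr (-8)" using lnC by (simp add: c_def)
      finally show "2 * exp 1 * c * (p / n) \<le> C powr (-8)" .
    qed (use p \<open>0 < c\<close> in auto)
    also have "\<dots> = exp (- (8 * (n * ln C)))"
      using C by (simp add: powr_def exp_of_nat_mult[symmetric])
    also have "\<dots> \<le> exp (- (2 * p))" using m2 lnC by (simp add: n_def field_simps)
    finally have R: "R \<le> exp (- (2 * p))" .
    have "cmod (\<integral>t. iexp (y * X t) * h t \<partial>M)
      \<le> ?L * (2 * K * exp (- p)) + (1 + ?L) * R * (\<integral>t. cmod (h t) \<partial>M)"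
    proof (rule integral_combination_bound[OF h X supp])
      fix t :: real assume t: "\<bar>t\<bar> \<le> A"
      show "cmod (iexp (y * t) - (\<Sum>i\<le>m. lagrange_weight m x y i * iexp (x i * t))) \<le> (1 + ?L) * R"
        unfolding R_def n_def
        by (rule exp_interpolation_error[OF inj t, of y u "2 * d"]) (use y in \<open>auto simp: abs_le_iff dest: rng(1) intro: order_trans[OF diff_right_mono[OF rng(2)]]\<close>)
    qed (use small xT in auto)
    also have "\<dots> \<le> exp 1 * exp (p / 4) * (2 * K * exp (- p)) + (1 + exp 1 * exp (p / 4)) * exp (- (2 * p)) * K"
      using L R K K0 d A
      by (intro add_mono mult_mono mult_nonneg_nonneg) (auto simp: R_def sum_nonneg intro!: add_nonneg_nonneg)
    also have "\<dots> = K * (exp 1 * exp (p / 4) * (2 * exp (- p)) + (1 + exp 1 * exp (p / 4)) * exp (- (2 * p)))"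
      by (simp add: algebra_simps)
    also have "\<dots> \<le> K * exp (- (p / 2))"
      by (intro mult_left_mono interpolation_constants[OF p] K0)
    finally show "cmod (\<integral>t. iexp (y * X t) * h t \<partial>M) \<le> K * exp (- (p / 2))" .
  qed
qed

section \<open>Uniqueness in one dimension\<close>

text \<open>From the distribution function \<phi> of \<open>S\<close> on \<open>[a, b]\<close>
  subtract a linear function of slope \<open>c\<close> and take a point \<open>x0\<close> where the
  difference is minimal. No later value is smaller, which says that every interval
  \<open>[x0, x0 + s]\<close> inside \<open>[a, b]\<close> meets \<open>S\<close> in proportion at
  least \<open>c\<close>.\<close>

lemma one_sided_density_point:
  fixes S :: "real set"
  assumes S: "closed S" and ab: "a < b" and pos: "0 < emeasure lborel (S \<inter> {a..b})"
  obtains c x0 where "0 < c" "c \<le> 1 / 2" "a \<le> x0" "x0 < b"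
    "\<And>s. 0 \<le> s \<Longrightarrow> x0 + s \<le> b \<Longrightarrow> ennreal (c * s) \<le> emeasure lborel (S \<inter> {x0..x0 + s})"
proof -
  have [measurable]: "S \<in> sets borel" using S by auto
  have fin: "emeasure lborel (S \<inter> {u..v}) \<noteq> \<infinity>" for u v :: real
  proof -
    have "emeasure lborel (S \<inter> {u..v}) \<le> emeasure lborel {u..v}" by (rule emeasure_mono) auto
    also have "\<dots> < \<infinity>" by (rule emeasure_bounded_finite) simp
    finally show ?thesis by simp
  qed
  define \<phi> where "\<phi> = (\<lambda>u v. measure lborel (S \<inter> {u..v}))"
  have em: "emeasure lborel (S \<inter> {u..v}) = ennreal (\<phi> u v)" for u v
    unfolding \<phi>_def using fin by (simp add: emeasure_eq_ennreal_measure)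
  have \<phi>_le: "\<phi> u v \<le> v - u" if "u \<le> v" for u v
  proof -
    have "\<phi> u v \<le> measure lborel {u..v}"
      unfolding \<phi>_def by (intro measure_mono_fmeasurable fmeasurableI emeasure_bounded_finite) auto
    then show ?thesis using that by simp
  qed
  have \<phi>_add: "\<phi> a v \<le> \<phi> a u + \<phi> u v" "\<phi> a u \<le> \<phi> a v" if "a \<le> u" "u \<le> v" for u v
  proof -
    have "\<phi> a v \<le> measure lborel ((S \<inter> {a..u}) \<union> (S \<inter> {u..v}))"
      unfolding \<phi>_def using fin by (intro measure_mono_fmeasurable fmeasurable.Un) (auto simp: fmeasurable_def top.not_eq_extremum)
    also have "\<dots> \<le> \<phi> a u + \<phi> u v"
      unfolding \<phi>_def using fin by (intro measure_Un_le) auto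
    finally show "\<phi> a v \<le> \<phi> a u + \<phi> u v" .
    show "\<phi> a u \<le> \<phi> a v"
      unfolding \<phi>_def using fin that by (intro measure_mono_fmeasurable) (auto simp: fmeasurable_def top.not_eq_extremum)
  qed
  \<comment> \<open>Half the mean density: the function minimized is then larger at \<open>b\<close>
    than at \<open>a\<close>, which keeps the minimum away from \<open>b\<close>. It also yields the
    bound \<open>1 / 2\<close>.\<close>
  define c where "c = \<phi> a b / (2 * (b - a))"
  have \<phi>pos: "0 < \<phi> a b" using pos em[of a b] by (simp add: ennreal_zero_less_divide)
  have c0: "0 < c" using \<phi>pos ab by (simp add: c_def)
  have c1: "c \<le> 1 / 2" using \<phi>_le[of a b] ab by (simp add: c_def field_simps)
  have "1-lipschitz_on {a..b} (\<phi> a)"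
  proof (rule lipschitz_onI)
    fix x y assume "x \<in> {a..b}" "y \<in> {a..b}"
    then show "dist (\<phi> a x) (\<phi> a y) \<le> 1 * dist x y"
      using \<phi>_add[of x y] \<phi>_add[of y x] \<phi>_le[of x y] \<phi>_le[of y x]
      by (cases "x \<le> y") (auto simp: dist_real_def)
  qed simp
  then have "continuous_on {a..b} (\<lambda>x. \<phi> a x - c * (x - a))"
    by (intro continuous_intros lipschitz_on_continuous_on)
  then obtain x0 where x0: "x0 \<in> {a..b}"
    and min: "\<And>x. x \<in> {a..b} \<Longrightarrow> \<phi> a x0 - c * (x0 - a) \<le> \<phi> a x - c * (x - a)"
    using continuous_attains_inf[of "{a..b}" "\<lambda>x. \<phi> a x - c * (x - a)"] ab by auto
  have "\<phi> a a = 0" using \<phi>_le[of a a] by (simp add: \<phi>_def measure_le_0_iff)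
  moreover have "c * (b - a) = \<phi> a b / 2" using ab by (simp add: c_def field_simps)
  ultimately have "x0 \<noteq> b" using min[of a] \<phi>pos ab by auto
  show thesis
  proof (rule that[of c x0])
    fix s :: real assume s: "0 \<le> s" "x0 + s \<le> b"
    have "\<phi> a x0 - c * (x0 - a) \<le> \<phi> a (x0 + s) - c * (x0 + s - a)" using min[of "x0 + s"] s x0 by auto
    then have "c * s \<le> \<phi> x0 (x0 + s)"
      using \<phi>_add(1)[of x0 "x0 + s"] s x0 by (simp add: algebra_simps)
    then show "ennreal (c * s) \<le> emeasure lborel (S \<inter> {x0..x0 + s})"
      unfolding em by (rule ennreal_leI)
  qed (use c0 c1 x0 \<open>x0 \<noteq> b\<close> in auto)
qed

text \<open>Lets step lengths be capped without losing divergence: if the capped series converged,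
  only finitely many of its terms could be capped.\<close>

lemma not_summable_min:
  fixes u :: "nat \<Rightarrow> real"
  assumes "\<not> summable u" "0 < r"
  shows "\<not> summable (\<lambda>k. min (u k) r)"
proof
  assume *: "summable (\<lambda>k. min (u k) r)"
  then have "\<forall>\<^sub>F k in sequentially. min (u k) r < r"
    using order_tendstoD(2)[OF summable_LIMSEQ_zero \<open>0 < r\<close>] by simp
  then have "\<forall>\<^sub>F k in sequentially. min (u k) r = u k" by eventually_elim auto
  then show False using * assms(1) summable_cong by metis
qed

lemma unbounded_partial_sums:
  fixes d :: "nat \<Rightarrow> real"
  assumes "\<not> summable d" "\<And>k. 0 \<le> d k"
  obtains N where "k \<le> N" "B < (\<Sum>j\<in>{k<..N}. d j)"
proof -
  have "\<exists>N\<ge>k. B < (\<Sum>j\<in>{k<..N}. d j)"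
  proof (rule ccontr)
    assume neg: "\<not> ?thesis"
    have "(\<Sum>j\<le>n. d j) \<le> (\<Sum>j\<le>k. d j) + B" for n
    proof -
      have "(\<Sum>j\<le>n. d j) \<le> (\<Sum>j\<in>{..k} \<union> {k<..max k n}. d j)"
        using assms(2) by (intro sum_mono2) auto
      also have "\<dots> = (\<Sum>j\<le>k. d j) + (\<Sum>j\<in>{k<..max k n}. d j)"
        by (rule sum.union_disjoint) auto
      also have "(\<Sum>j\<in>{k<..max k n}. d j) \<le> B" using neg by (meson max.cobounded1 not_less)
      finally show ?thesis by simp
    qed
    then have "summable d" by (rule bounded_imp_summable[OF assms(2)])
    then show False using assms(1) by simp
  qed
  then show thesis using that by blast
qed

lemma exp_neg_two_power_tendsto_0: "(\<lambda>k. exp (- (2 ^ k :: real))) \<longlonglongrightarrow> 0"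
proof (rule tendsto_sandwich[OF _ _ tendsto_const])
  show "(\<lambda>k. exp (-1) ^ k :: real) \<longlonglongrightarrow> 0" by (rule LIMSEQ_realpow_zero) auto
  show "\<forall>\<^sub>F k in sequentially. exp (- (2 ^ k)) \<le> exp (-1 :: real) ^ k"
    by (intro always_eventually) (auto simp: exp_of_nat_mult[symmetric] intro: less_imp_le of_nat_less_two_power)
qed auto

text \<open>For a fixed level \<open>k\<close> the descent may start at any higher level
  \<open>N\<close>, where nothing has to be known. Divergence makes the length gained between
  \<open>N\<close> and \<open>k\<close> exceed any bound, so the estimate at level \<open>k\<close>
  reaches \<open>y\<close>; letting \<open>k\<close> tend to infinity gives zero.\<close>

lemma transform_vanishes_beyond:
  fixes h :: "'a \<Rightarrow> complex" and X :: "'a \<Rightarrow> real"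
  assumes h: "integrable M h" and X [measurable]: "X \<in> borel_measurable M"
    and K: "(\<integral>t. cmod (h t) \<partial>M) \<le> K"
    and tail: "\<And>k. (\<integral>t. (if A k \<le> \<bar>X t\<bar> then cmod (h t) else 0) \<partial>M) \<le> K * exp (- (2 ^ k))"
    and Apos: "\<And>k. 0 < A k" and Amono: "\<And>k. A k \<le> A (Suc k)"
    and div: "\<not> summable (\<lambda>k. 2 ^ k / A k)"
    and S: "closed S" "a < b" "0 < emeasure lborel (S \<inter> {a..b})"
    and zero: "\<And>y. y \<in> S \<Longrightarrow> (\<integral>t. iexp (y * X t) * h t \<partial>M) = 0"
    and y: "b \<le> y"
  shows "(\<integral>t. iexp (y * X t) * h t \<partial>M) = 0"
proof -
  have [measurable]: "h \<in> borel_measurable M" using h by auto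
  have K0: "0 \<le> K" by (rule order_trans[OF Bochner_Integration.integral_nonneg K]) auto
  define g where "g = (\<lambda>k t. if \<bar>X t\<bar> < A k then h t else 0)"
  have [measurable]: "g k \<in> borel_measurable M" for k unfolding g_def by measurable
  have g: "integrable M (g k)" for k
    by (rule Bochner_Integration.integrable_bound[OF integrable_norm[OF h]]) (auto simp: g_def)
  have int: "integrable M (\<lambda>t. iexp (z * X t) * q t)" if "integrable M q" for z q
  proof -
    have [measurable]: "q \<in> borel_measurable M" using that by auto
    show ?thesis
      by (rule Bochner_Integration.integrable_bound[OF integrable_norm[OF that]]) (auto simp: norm_mult)
  qed
  have Kg: "(\<integral>t. cmod (g k t) \<partial>M) \<le> K" for k
    by (rule order_trans[OF Bochner_Integration.integral_mono K]) (use g h in \<open>auto simp: g_def\<close>)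
  have bound: "cmod ((\<integral>t. iexp (z * X t) * q t \<partial>M) - (\<integral>t. iexp (z * X t) * g k t \<partial>M)) \<le> K * exp (- (2 ^ k))"
    if q: "integrable M q" and qg: "\<And>t. cmod (q t - g k t) \<le> (if A k \<le> \<bar>X t\<bar> then cmod (h t) else 0)" for q z k
  proof -
    have "(\<integral>t. iexp (z * X t) * q t \<partial>M) - (\<integral>t. iexp (z * X t) * g k t \<partial>M)
        = (\<integral>t. iexp (z * X t) * (q t - g k t) \<partial>M)"
      by (subst Bochner_Integration.integral_diff[OF int[OF q] int[OF g], symmetric]) (simp add: right_diff_distrib)
    also have "cmod \<dots> \<le> (\<integral>t. (if A k \<le> \<bar>X t\<bar> then cmod (h t) else 0) \<partial>M)"
    proof (rule order_trans[OF integral_norm_bound Bochner_Integration.integral_mono])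
      show "integrable M (\<lambda>t. cmod (iexp (z * X t) * (q t - g k t)))"
        by (intro integrable_norm int Bochner_Integration.integrable_diff q g)
      show "integrable M (\<lambda>t. if A k \<le> \<bar>X t\<bar> then cmod (h t) else 0)"
        by (rule Bochner_Integration.integrable_bound[OF integrable_norm[OF h]]) auto
      show "cmod (iexp (z * X t) * (q t - g k t)) \<le> (if A k \<le> \<bar>X t\<bar> then cmod (h t) else 0)" for t
        using qg[of t] by (simp add: norm_mult)
    qed
    finally show ?thesis using tail[of k] by linarith
  qed
  define F where "F = (\<lambda>k z. cmod (\<integral>t. iexp (z * X t) * g k t \<partial>M))"
  define f where "f = (\<lambda>z. cmod (\<integral>t. iexp (z * X t) * h t \<partial>M))"
  have hg: "cmod (h t - g k t) \<le> (if A k \<le> \<bar>X t\<bar> then cmod (h t) else 0)" for k t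
    by (simp add: g_def)
  have gg: "cmod (g (Suc k) t - g k t) \<le> (if A k \<le> \<bar>X t\<bar> then cmod (h t) else 0)" for k t
    using Amono[of k] by (simp add: g_def)
  have fF: "f z \<le> F k z + K * exp (- (2 ^ k))" "F k z \<le> f z + K * exp (- (2 ^ k))" for k z
    using bound[OF h hg, of z k] norm_triangle_ineq3[of "\<integral>t. iexp (z * X t) * h t \<partial>M" "\<integral>t. iexp (z * X t) * g k t \<partial>M"]
    unfolding F_def f_def by linarith+
  have FF: "F k z \<le> F (Suc k) z + K * exp (- (2 ^ k))" for k z
    using bound[OF g gg, of z k]
      norm_triangle_ineq3[of "\<integral>t. iexp (z * X t) * g (Suc k) t \<partial>M" "\<integral>t. iexp (z * X t) * g k t \<partial>M"]
    unfolding F_def by linarith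
  obtain c0 x0 where c0: "0 < c0" "c0 \<le> 1 / 2" and x0: "a \<le> x0" "x0 < b"
    and dens: "\<And>s. 0 \<le> s \<Longrightarrow> x0 + s \<le> b \<Longrightarrow> ennreal (c0 * s) \<le> emeasure lborel (S \<inter> {x0..x0 + s})"
    using one_sided_density_point[OF S] by metis
  have "c0 \<le> 1" using c0 by simp
  then obtain c where c: "0 < c" and propagate:
    "\<And>(M :: 'a measure) h X A K p u d T y. integrable M h \<Longrightarrow> X \<in> borel_measurable M \<Longrightarrow>
       (\<And>t. t \<in> space M \<Longrightarrow> h t \<noteq> 0 \<Longrightarrow> \<bar>X t\<bar> \<le> A) \<Longrightarrow> (\<integral>t. cmod (h t) \<partial>M) \<le> K \<Longrightarrow> 0 < A \<Longrightarrow>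
       16 \<le> p \<Longrightarrow> 0 < d \<Longrightarrow> d \<le> c * p / A \<Longrightarrow>
       closed T \<Longrightarrow> T \<subseteq> {u..u + 2 * d} \<Longrightarrow> ennreal (c0 * d) \<le> emeasure lborel T \<Longrightarrow>
       (\<And>z. z \<in> T \<Longrightarrow> cmod (\<integral>t. iexp (z * X t) * h t \<partial>M) \<le> 2 * K * exp (- p)) \<Longrightarrow>
       y \<in> {u..u + 2 * d} \<Longrightarrow> cmod (\<integral>t. iexp (y * X t) * h t \<partial>M) \<le> K * exp (- (p / 2))"
    using smallness_propagates[OF c0(1), where ?'a = 'a] by blast
  \<comment> \<open>The cap on the step lengths keeps the window \<open>[x0, x0 + 2 * d k]\<close>
    inside \<open>[x0, b]\<close>, where the density bound is available.\<close>
  define r where "r = (b - x0) / 2"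
  have r: "0 < r" using x0 by (simp add: r_def)
  define d where "d = (\<lambda>k. min (c * (2 ^ k / A k)) r)"
  have d0: "0 < d k" for k using c Apos[of k] r by (simp add: d_def)
  have dA: "d k \<le> c * 2 ^ k / A k" for k by (simp add: d_def)
  have dr: "d k \<le> r" for k by (simp add: d_def)
  have "\<not> summable (\<lambda>k. c * (2 ^ k / A k))" using div c by (subst summable_cmult_iff) simp
  then have ddiv: "\<not> summable d" unfolding d_def by (rule not_summable_min[OF _ r])
  \<comment> \<open>The factor 2 holds two equal contributions: the bound propagated from level
    \<open>k + 1\<close> and the error of replacing that truncation by the one at level
    \<open>k\<close>.\<close>
  define good where "good = (\<lambda>k z. F k z \<le> 2 * K * exp (- (2 ^ k)))"
  have goodS: "good k z" if "z \<in> S" for k z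
    using fF(2)[of k z] zero[OF that] mult_nonneg_nonneg[OF K0 exp_ge_zero[of "- (2 ^ k)"]]
    by (simp add: good_def f_def)
  have extend: "F k z \<le> K * exp (- (2 ^ k / 2))"
    if k: "4 \<le> k" and t: "0 \<le> t" and good: "\<And>z. x0 \<le> z \<Longrightarrow> z < x0 + t \<Longrightarrow> good k z"
      and z: "x0 + t \<le> z" "z < x0 + t + d k" for k t z
  proof -
    have p: "(16::real) \<le> 2 ^ k" using power_increasing[OF k, of "2::real"] by simp
    have supp: "g k s \<noteq> 0 \<Longrightarrow> \<bar>X s\<bar> \<le> A k" for s by (auto simp: g_def split: if_splits)
    note step = propagate[OF g[of k] X supp Kg Apos p d0[of k] dA]
    \<comment> \<open>If the good interval is at least one step long, a window straddling its right
      end is used. Otherwise the window restarts at \<open>x0\<close>, with \<open>S\<close> itself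
      as the set of small values.\<close>
    show ?thesis
    proof (cases "d k \<le> t")
      case True
      show ?thesis
        unfolding F_def
      proof (rule step[of "{x0 + t - d k..x0 + t - d k / 2}" "x0 + t - d k"])
        \<comment> \<open>Only the first half of the good part of the window is used, because the
          good interval is half-open at \<open>x0 + t\<close>; \<open>c0 \<le> 1 / 2\<close> makes
          this half long enough.\<close>
        have "c0 * d k \<le> d k / 2" using mult_right_mono[OF c0(2), of "d k"] d0[of k] by simp
        then show "ennreal (c0 * d k) \<le> emeasure lborel {x0 + t - d k..x0 + t - d k / 2}"
          using d0[of k] by (simp add: emeasure_lborel_Icc_eq ennreal_leI)
        show "cmod (\<integral>s. iexp (w * X s) * g k s \<partial>M) \<le> 2 * K * exp (- (2 ^ k))"
          if "w \<in> {x0 + t - d k..x0 + t - d k / 2}" for w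
          using good[of w] that True d0[of k] by (auto simp: good_def F_def)
      qed (use z d0[of k] in auto)
    next
      case False
      show ?thesis
        unfolding F_def
      proof (rule step[of "S \<inter> {x0..x0 + d k}" x0])
        show "ennreal (c0 * d k) \<le> emeasure lborel (S \<inter> {x0..x0 + d k})"
          using d0[of k] dr[of k] r by (intro dens) (auto simp: r_def field_simps)
        show "cmod (\<integral>s. iexp (w * X s) * g k s \<partial>M) \<le> 2 * K * exp (- (2 ^ k))"
          if "w \<in> S \<inter> {x0..x0 + d k}" for w
          using goodS[of w k] that by (auto simp: good_def F_def)
      qed (use z t False d0[of k] S(1) in auto)
    qed
  qed
  \<comment> \<open>Downward induction from \<open>N\<close>, where the sum is empty and the claim
    is void. The restriction \<open>4 \<le> k\<close> ensures \<open>16 \<le> 2 ^ k\<close>, which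
    the Remez step demands of its exponent.\<close>
  have descend: "\<forall>z. x0 \<le> z \<longrightarrow> z < x0 + (\<Sum>j\<in>{k<..N}. d j) \<longrightarrow> good k z" if "4 \<le> k" "k \<le> N" for k N
    using that(2,1)
  proof (induction k rule: inc_induct)
    case base
    then show ?case by simp
  next
    case (step k)
    define t where "t = (\<Sum>j\<in>{Suc k<..N}. d j)"
    have "{k<..N} = insert (Suc k) {Suc k<..N}" using step.hyps by auto
    then have sum: "(\<Sum>j\<in>{k<..N}. d j) = t + d (Suc k)" by (simp add: t_def)
    have IH: "good (Suc k) z" if "x0 \<le> z" "z < x0 + t" for z
      using step.IH step.prems that by (simp add: t_def)
    have t: "0 \<le> t" unfolding t_def by (intro sum_nonneg less_imp_le[OF d0])
    show ?case
    proof (intro allI impI)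
      fix z assume z: "x0 \<le> z" "z < x0 + (\<Sum>j\<in>{k<..N}. d j)"
      have "F (Suc k) z \<le> K * exp (- (2 ^ k))"
      proof (cases "z < x0 + t")
        case True
        \<comment> \<open>Points that were good already carry a factor 2, which the drop of the
          exponent from \<open>2 ^ Suc k\<close> to \<open>2 ^ k\<close> absorbs.\<close>
        have "(2::real) \<le> 1 + 2 ^ k" by simp
        also have "\<dots> \<le> exp (2 ^ k)" by (rule exp_ge_add_one_self)
        finally have "2 * exp (- (2 ^ Suc k)) \<le> exp (2 ^ k) * exp (- (2 ^ Suc k :: real))"
          by (intro mult_right_mono) auto
        also have "\<dots> = exp (- (2 ^ k))" by (simp add: exp_add[symmetric])
        finally have "K * (2 * exp (- (2 ^ Suc k))) \<le> K * exp (- (2 ^ k))"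
          using K0 by (rule mult_left_mono)
        then show ?thesis using IH[OF z(1) True] by (simp add: good_def)
      next
        case False
        then show ?thesis using extend[of "Suc k" t z] step.prems t IH z sum by auto
      qed
      then show "good k z" using FF[of k z] by (simp add: good_def)
    qed
  qed
  have small: "f y \<le> 3 * K * exp (- (2 ^ k))" if k: "4 \<le> k" for k
  proof -
    obtain N where "k \<le> N" "y - x0 < (\<Sum>j\<in>{k<..N}. d j)"
      using unbounded_partial_sums[OF ddiv less_imp_le[OF d0]] by metis
    then have "good k y" using descend[OF k, of N] x0 y by auto
    then show ?thesis using fF(1)[of y k] by (simp add: good_def)
  qed
  have "f y \<le> 3 * K * 0"
  proof (rule tendsto_lowerbound)
    show "(\<lambda>k. 3 * K * exp (- (2 ^ k))) \<longlonglongrightarrow> 3 * K * 0"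
      by (intro tendsto_mult tendsto_const exp_neg_two_power_tendsto_0)
    show "\<forall>\<^sub>F k in sequentially. f y \<le> 3 * K * exp (- (2 ^ k))"
      using small by (auto simp: eventually_at_top_linorder)
  qed simp
  then show ?thesis by (simp add: f_def)
qed

section \<open>Dyadic levels of \<psi> and the divergence of the associated series\<close>

lemma nn_integral_Cauchy_kernel_tail:
  assumes "0 \<le> (a::real)"
  shows "(\<integral>\<^sup>+x. ennreal (2 / (1 + x)\<^sup>2) * indicator {a..} x \<partial>lborel) = ennreal (2 / (1 + a))"
proof -
  have "(\<integral>\<^sup>+x. ennreal (2 / (1 + x)\<^sup>2) * indicator {a..} x \<partial>lborel) = ennreal (0 - (- 2 / (1 + a)))"
  proof (rule nn_integral_FTC_atLeast)
    show "((\<lambda>x::real. - 2 / (1 + x)) \<longlongrightarrow> 0) at_top" by real_asymp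
    fix x assume "a \<le> x"
    then show "((\<lambda>x. - 2 / (1 + x)) has_real_derivative 2 / (1 + x)\<^sup>2) (at x)"
      using assms by (auto intro!: derivative_eq_intros simp: power2_eq_square)
  qed auto
  then show ?thesis by simp
qed

text \<open>A layer-cake estimate: with \<open>a k\<close> the infimum of the level set
  \<open>\<psi> x \<ge> 2 ^ k\<close>, \<psi> is at most 2 plus the sum of the steps
  \<open>2 ^ Suc k\<close> on \<open>{a k..}\<close>. Integration bounds \<open>I\<close> by 4 plus
  4 times the sum of \<open>2 ^ k / (1 + a k)\<close>.\<close>

lemma divergent_levels:
  fixes \<psi> :: "real \<Rightarrow> real"
  assumes nonneg: "\<And>x. 0 \<le> x \<Longrightarrow> 0 \<le> \<psi> x"
    and incr: "mono_on {0..} \<psi>"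
    and lim: "filterlim \<psi> at_top at_top"
    and I: "(\<integral>\<^sup>+x\<in>{0..}. ennreal (\<psi> x / (1 + x\<^sup>2)) \<partial>lborel) = \<infinity>"
  obtains A :: "nat \<Rightarrow> real" where "\<And>k. 0 < A k" "\<And>k. A k \<le> A (Suc k)" "\<And>k. 2 ^ k \<le> \<psi> (A k)"
    "\<not> summable (\<lambda>k. 2 ^ k / A k)"
proof -
  define L where "L = (\<lambda>k::nat. {x. 0 \<le> x \<and> 2 ^ k \<le> \<psi> x})"
  define a where "a = (\<lambda>k. Inf (L k))"
  have bdd: "bdd_below (L k)" for k by (rule bdd_belowI[of _ 0]) (auto simp: L_def)
  have ne: "L k \<noteq> {}" for k
  proof -
    have "\<forall>\<^sub>F x in at_top. 2 ^ k \<le> \<psi> x \<and> 0 \<le> x"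
      using lim eventually_ge_at_top[of 0] by (auto simp: filterlim_at_top intro: eventually_conj)
    then obtain x where "2 ^ k \<le> \<psi> x \<and> 0 \<le> x" using eventually_happens'[OF trivial_limit_at_top_linorder] by blast
    then show ?thesis by (auto simp: L_def)
  qed
  have a0: "0 \<le> a k" for k unfolding a_def by (rule cInf_greatest[OF ne]) (auto simp: L_def)
  have a_le: "a k \<le> x" if "0 \<le> x" "2 ^ k \<le> \<psi> x" for k x
    unfolding a_def by (rule cInf_lower[OF _ bdd]) (use that in \<open>auto simp: L_def\<close>)
  \<comment> \<open>Without continuity the infimum \<open>a k\<close> may miss the level set; the
    shift by 1 moves into it, makes the level positive, and gives exactly the denominators of the
    layer-cake bound.\<close>
  show thesis
  proof (rule that[of "\<lambda>k. 1 + a k"])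
    fix k
    show "0 < 1 + a k" using a0[of k] by simp
    have "L (Suc k) \<subseteq> L k"
      using power_increasing[of k "Suc k" "2::real"] by (auto simp: L_def intro: order_trans[rotated])
    then show "1 + a k \<le> 1 + a (Suc k)"
      unfolding a_def using cInf_superset_mono[OF ne bdd] by simp
    obtain x where "x \<in> L k" "x < 1 + a k"
      using cInf_lessD[OF ne, of k "1 + a k"] by (auto simp: a_def)
    then show "2 ^ k \<le> \<psi> (1 + a k)"
      using mono_onD[OF incr, of x "1 + a k"] a0[of k] by (auto simp: L_def)
  next
    show "\<not> summable (\<lambda>k. 2 ^ k / (1 + a k))"
    proof
      assume sm: "summable (\<lambda>k. 2 ^ k / (1 + a k))"
      \<comment> \<open>This majorant of \<open>1 / (1 + x\<^sup>2)\<close> is used because its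
        integral over \<open>{a..}\<close> is exactly \<open>2 / (1 + a)\<close>.\<close>
      define w where "w = (\<lambda>x::real. ennreal (2 / (1 + x)\<^sup>2))"
      have [measurable]: "w \<in> borel_measurable borel" unfolding w_def by measurable
      have \<psi>_le: "ennreal (\<psi> x) \<le> 2 + (\<Sum>k. ennreal (2 ^ Suc k) * indicator {a k..} x)" if x: "0 \<le> x" for x
      proof (cases "\<psi> x < 2")
        case True
        then show ?thesis
          using ennreal_leI[of "\<psi> x" 2] by (intro add_increasing2) auto
      next
        case False
        obtain N where N: "\<psi> x < 2 ^ N" using real_arch_pow[of 2 "\<psi> x"] by auto
        define n where "n = (LEAST n. \<psi> x < 2 ^ n)"
        have n: "\<psi> x < 2 ^ n" unfolding n_def using N by (rule LeastI)
        have "n \<noteq> 0"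
        proof
          assume "n = 0"
          then show False using n False by simp
        qed
        then obtain m where m: "n = Suc m" by (cases n) auto
        have "2 ^ m \<le> \<psi> x" using not_less_Least[of m "\<lambda>n. \<psi> x < 2 ^ n"] m n_def by auto
        then have "a m \<le> x" using a_le x by simp
        have "ennreal (\<psi> x) \<le> ennreal (2 ^ Suc m) * indicator {a m..} x"
          using n m \<open>a m \<le> x\<close> by (simp add: ennreal_leI del: power_Suc)
        also have "\<dots> = (\<Sum>k\<in>{m}. ennreal (2 ^ Suc k) * indicator {a k..} x)"
          by (subst sum.insert) simp_all
        also have "\<dots> \<le> (\<Sum>k. ennreal (2 ^ Suc k) * indicator {a k..} x)"
          by (rule sum_le_suminf) auto
        also have "\<dots> \<le> 2 + (\<Sum>k. ennreal (2 ^ Suc k) * indicator {a k..} x)" by simp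
        finally show ?thesis .
      qed
      have "(\<integral>\<^sup>+x\<in>{0..}. ennreal (\<psi> x / (1 + x\<^sup>2)) \<partial>lborel)
         \<le> (\<integral>\<^sup>+x. 2 * (w x * indicator {0..} x) + (\<Sum>k. ennreal (2 ^ Suc k) * (w x * indicator {a k..} x)) \<partial>lborel)"
      proof (rule nn_integral_mono)
        fix x :: real
        show "ennreal (\<psi> x / (1 + x\<^sup>2)) * indicator {0..} x
           \<le> 2 * (w x * indicator {0..} x) + (\<Sum>k. ennreal (2 ^ Suc k) * (w x * indicator {a k..} x))"
        proof (cases "0 \<le> x")
          case True
          have "0 \<le> (x - 1)\<^sup>2" by simp
          then have "(1 + x)\<^sup>2 \<le> 2 * (1 + x\<^sup>2)" by (simp add: power2_eq_square algebra_simps)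
          then have "2 / (2 * (1 + x\<^sup>2)) \<le> 2 / (1 + x)\<^sup>2"
            using True by (intro divide_left_mono) (auto intro!: mult_pos_pos add_pos_nonneg)
          moreover have "2 / (2 * s) = 1 / s" for s :: real by simp
          ultimately have "1 / (1 + x\<^sup>2) \<le> 2 / (1 + x)\<^sup>2" by (simp only:)
          then have "\<psi> x / (1 + x\<^sup>2) \<le> \<psi> x * (2 / (1 + x)\<^sup>2)"
            using mult_left_mono[OF _ nonneg[OF True]] by fastforce
          then have "ennreal (\<psi> x / (1 + x\<^sup>2)) \<le> ennreal (\<psi> x) * w x"
            using nonneg[OF True] by (simp add: w_def ennreal_mult[symmetric] ennreal_leI del: times_divide_eq_right)
          also have "\<dots> \<le> (2 + (\<Sum>k. ennreal (2 ^ Suc k) * indicator {a k..} x)) * w x"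
            using \<psi>_le[OF True] by (rule mult_right_mono) simp
          also have "\<dots> = 2 * w x + (\<Sum>k. ennreal (2 ^ Suc k) * indicator {a k..} x * w x)"
            by (simp only: distrib_right ennreal_suminf_multc)
          finally show ?thesis using True by (simp add: mult_ac)
        qed (simp add: indicator_def)
      qed
      also have "\<dots> = 2 * (\<integral>\<^sup>+x. w x * indicator {0..} x \<partial>lborel)
          + (\<Sum>k. ennreal (2 ^ Suc k) * (\<integral>\<^sup>+x. w x * indicator {a k..} x \<partial>lborel))"
        by (simp add: nn_integral_add nn_integral_cmult nn_integral_suminf)
      also have "\<dots> = 2 * ennreal 2 + (\<Sum>k. ennreal (4 * (2 ^ k / (1 + a k))))"
        unfolding w_def nn_integral_Cauchy_kernel_tail[OF a0] nn_integral_Cauchy_kernel_tail[OF order_refl]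
        using a0 by (simp add: ennreal_mult[symmetric] mult_ac)
      also have "\<dots> < \<infinity>"
        using summable_mult[OF sm, of 4] a0 by (subst suminf_ennreal2) (auto simp: ennreal_mult_less_top simp del: ennreal_numeral)
      finally show False using I by simp
    qed
  qed
qed

text \<open>Levy's uniqueness theorem compares probability distributions, so it is applied to the
  laws of \<open>X\<close> under the normalized positive and negative parts of \<open>h\<close>. The
  hypothesis at \<open>y = 0\<close> shows that both parts have the same mass
  \<open>c\<close>.\<close>

lemma integral_indicator_eq_0_real:
  fixes h :: "'a \<Rightarrow> real" and X :: "'a \<Rightarrow> real"
  assumes h: "integrable M h" and X [measurable]: "X \<in> borel_measurable M"
    and zero: "\<And>y. (\<integral>t. iexp (y * X t) * of_real (h t) \<partial>M) = 0" and B [measurable]: "B \<in> sets borel"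
  shows "(\<integral>t. indicator B (X t) * h t \<partial>M) = 0"
proof -
  have [measurable]: "h \<in> borel_measurable M" using h by auto
  define p where "p = (\<lambda>t. max 0 (h t))"
  define n where "n = (\<lambda>t. max 0 (- h t))"
  have hpn: "h t = p t - n t" for t by (simp add: p_def n_def max_def)
  have [measurable]: "p \<in> borel_measurable M" "n \<in> borel_measurable M" unfolding p_def n_def by measurable
  have p: "integrable M p" and n: "integrable M n" unfolding p_def n_def using h by auto
  have nn: "0 \<le> p t" "0 \<le> n t" for t by (auto simp: p_def n_def)
  have intX: "integrable M (\<lambda>t. q t *\<^sub>R F (X t))"
    if q: "integrable M q" and F [measurable]: "F \<in> borel_measurable borel" and bd: "\<And>x. norm (F x) \<le> 1"
    for q and F :: "real \<Rightarrow> 'b::{banach, second_countable_topology}"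
  proof -
    have [measurable]: "q \<in> borel_measurable M" using q by auto
    show ?thesis
      by (rule Bochner_Integration.integrable_bound[OF integrable_norm[OF q]])
         (use bd in \<open>auto intro!: AE_I2 mult_left_le\<close>)
  qed
  have eq: "(\<integral>t. p t *\<^sub>R iexp (y * X t) \<partial>M) = (\<integral>t. n t *\<^sub>R iexp (y * X t) \<partial>M)" for y
  proof -
    have "(\<integral>t. p t *\<^sub>R iexp (y * X t) \<partial>M) - (\<integral>t. n t *\<^sub>R iexp (y * X t) \<partial>M)
      = (\<integral>t. p t *\<^sub>R iexp (y * X t) - n t *\<^sub>R iexp (y * X t) \<partial>M)"
      using intX[OF p, of "\<lambda>x. iexp (y * x)"] intX[OF n, of "\<lambda>x. iexp (y * x)"]
      by (subst Bochner_Integration.integral_diff) auto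
    also have "\<dots> = (\<integral>t. iexp (y * X t) * of_real (h t) \<partial>M)"
      by (intro Bochner_Integration.integral_cong) (auto simp: hpn scaleR_conv_of_real algebra_simps)
    finally show ?thesis using zero by simp
  qed
  define c where "c = (\<integral>t. p t \<partial>M)"
  have c0: "0 \<le> c" unfolding c_def using nn by simp
  have cn: "c = (\<integral>t. n t \<partial>M)"
  proof -
    have "complex_of_real c = complex_of_real (\<integral>t. n t \<partial>M)"
      using eq[of 0] by (simp add: c_def scaleR_conv_of_real)
    then show ?thesis by (simp only: of_real_eq_iff)
  qed
  have split: "(\<integral>t. indicator B (X t) * h t \<partial>M)
      = (\<integral>t. p t *\<^sub>R indicator B (X t) \<partial>M) - (\<integral>t. n t *\<^sub>R indicator B (X t) \<partial>M)"
    using intX[OF p, of "indicator B :: real \<Rightarrow> real"] intX[OF n, of "indicator B :: real \<Rightarrow> real"]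
    by (subst Bochner_Integration.integral_diff[symmetric]) (auto simp: hpn algebra_simps)
  show ?thesis
  proof (cases "c = 0")
    \<comment> \<open>Nothing can be normalized here, but both parts of \<open>h\<close> then vanish
      almost everywhere.\<close>
    case True
    then have "AE t in M. p t = 0" "AE t in M. n t = 0"
      using integral_nonneg_eq_0_iff_AE[OF p] integral_nonneg_eq_0_iff_AE[OF n] nn cn by (auto simp: c_def)
    then have "AE t in M. indicator B (X t) * h t = 0" by eventually_elim (simp add: hpn)
    then have "(\<integral>t. indicator B (X t) * h t \<partial>M) = (\<integral>t. 0 \<partial>M)" by (intro integral_cong_AE) auto
    then show ?thesis by simp
  next
    case False
    then have c: "0 < c" using c0 by simp
    define \<nu> where "\<nu> = (\<lambda>q. distr (density M (\<lambda>t. ennreal (q t / c))) borel X)"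
    have rd: "real_distribution (\<nu> q)" and char\<nu>: "char (\<nu> q) y = (\<integral>t. q t *\<^sub>R iexp (y * X t) \<partial>M) / c"
      and meas\<nu>: "measure (\<nu> q) B = (\<integral>t. q t *\<^sub>R indicator B (X t) \<partial>M) / c"
      if q: "integrable M q" "\<And>t. 0 \<le> q t" "(\<integral>t. q t \<partial>M) = c" for q y
    proof -
      have [measurable]: "q \<in> borel_measurable M" using q by auto
      have "(\<integral>\<^sup>+t. ennreal (q t / c) \<partial>M) = ennreal (\<integral>t. q t / c \<partial>M)"
        using q c by (intro nn_integral_eq_integral) auto
      also have "\<dots> = 1" using q c by simp
      finally have "prob_space (density M (\<lambda>t. ennreal (q t / c)))"
        by (intro prob_spaceI) (simp add: emeasure_density cong: nn_integral_cong)
      then have "prob_space (\<nu> q)" unfolding \<nu>_def by (rule prob_space.prob_space_distr) simp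
      then show rd: "real_distribution (\<nu> q)" by (simp add: real_distribution_def real_distribution_axioms_def \<nu>_def)
      have "char (\<nu> q) y = (\<integral>t. (q t / c) *\<^sub>R iexp (y * X t) \<partial>M)"
        unfolding char_def \<nu>_def using q c by (simp add: integral_distr integral_density)
      also have "\<dots> = (\<integral>t. (1 / c) *\<^sub>R (q t *\<^sub>R iexp (y * X t)) \<partial>M)" by simp
      also have "\<dots> = (\<integral>t. q t *\<^sub>R iexp (y * X t) \<partial>M) / c"
        by (subst Bochner_Integration.integral_scaleR_right) (simp add: scaleR_conv_of_real)
      finally show "char (\<nu> q) y = (\<integral>t. q t *\<^sub>R iexp (y * X t) \<partial>M) / c" .
      have "measure (\<nu> q) B = (\<integral>x. indicator B x \<partial>\<nu> q)" by (simp add: \<nu>_def)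
      also have "\<dots> = (\<integral>t. (q t / c) *\<^sub>R indicator B (X t) \<partial>M)"
        unfolding \<nu>_def using q c by (subst integral_distr, simp, simp, subst integral_density) auto
      also have "\<dots> = (\<integral>t. q t *\<^sub>R indicator B (X t) \<partial>M) / c" by simp
      finally show "measure (\<nu> q) B = (\<integral>t. q t *\<^sub>R indicator B (X t) \<partial>M) / c" .
    qed
    have "char (\<nu> p) = char (\<nu> n)"
      using char\<nu>[OF p nn(1) c_def[symmetric]] char\<nu>[OF n nn(2) cn[symmetric]] eq by auto
    then have "\<nu> p = \<nu> n"
      using Levy_uniqueness rd[OF p nn(1) c_def[symmetric]] rd[OF n nn(2) cn[symmetric]] by blast
    then have "(\<integral>t. p t *\<^sub>R indicat_real B (X t) \<partial>M) = (\<integral>t. n t *\<^sub>R indicat_real B (X t) \<partial>M)"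
      using meas\<nu>[OF p nn(1) c_def[symmetric]] meas\<nu>[OF n nn(2) cn[symmetric]] c by simp
    then show ?thesis by (simp add: split)
  qed
qed

text \<open>The transform vanishes at \<open>- y\<close> as well as at \<open>y\<close>, so taking
  conjugates shows that the transform of \<open>Re h\<close> vanishes too. The imaginary part
  follows by passing to \<open>- \<i> * h\<close>.\<close>

lemma integral_indicator_eq_0:
  fixes h :: "'a \<Rightarrow> complex" and X :: "'a \<Rightarrow> real"
  assumes h: "integrable M h" and X [measurable]: "X \<in> borel_measurable M"
    and zero: "\<And>y. (\<integral>t. iexp (y * X t) * h t \<partial>M) = 0" and B [measurable]: "B \<in> sets borel"
  shows "(\<integral>t. indicator B (X t) * h t \<partial>M) = 0"
proof -
  have Re0: "(\<integral>t. indicator B (X t) * Re (q t) \<partial>M) = 0"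
    if q: "integrable M q" and z: "\<And>y. (\<integral>t. iexp (y * X t) * q t \<partial>M) = 0" for q :: "'a \<Rightarrow> complex"
  proof (rule integral_indicator_eq_0_real[OF _ X _ B])
    show "integrable M (\<lambda>t. Re (q t))" using q by simp
    have [measurable]: "q \<in> borel_measurable M" using q by auto
    have int: "integrable M (\<lambda>t. iexp (y * X t) * q t)" for y
      by (rule Bochner_Integration.integrable_bound[OF integrable_norm[OF q]]) (auto simp: norm_mult)
    fix y
    have "(\<integral>t. iexp (y * X t) * of_real (Re (q t)) \<partial>M)
        = (\<integral>t. (iexp (y * X t) * q t + cnj (iexp (- y * X t) * q t)) / 2 \<partial>M)"
    proof (intro Bochner_Integration.integral_cong refl)
      fix t
      have "cnj (iexp (- y * X t) * q t) = iexp (y * X t) * cnj (q t)"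
        by (simp add: exp_cnj)
      then show "iexp (y * X t) * of_real (Re (q t)) = (iexp (y * X t) * q t + cnj (iexp (- y * X t) * q t)) / 2"
        by (simp only: distrib_left[symmetric] complex_add_cnj) simp
    qed
    also have "\<dots> = ((\<integral>t. iexp (y * X t) * q t \<partial>M) + cnj (\<integral>t. iexp (- y * X t) * q t \<partial>M)) / 2"
      using int[of y] int[of "- y"] by (simp del: complex_cnj_mult add: Bochner_Integration.integral_add integral_cnj)
    finally show "(\<integral>t. iexp (y * X t) * of_real (Re (q t)) \<partial>M) = 0" unfolding z by simp
  qed
  have int: "integrable M (\<lambda>t. indicator B (X t) * h t)"
  proof -
    have [measurable]: "h \<in> borel_measurable M" using h by auto
    show ?thesis
      by (rule Bochner_Integration.integrable_bound[OF integrable_norm[OF h]]) (auto simp: indicator_def)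
  qed
  have "Re (\<integral>t. indicator B (X t) * h t \<partial>M) = (\<integral>t. indicator B (X t) * Re (h t) \<partial>M)"
    by (subst integral_Re[OF int, symmetric]) (auto intro!: Bochner_Integration.integral_cong simp: indicator_def)
  moreover have "Im (\<integral>t. indicator B (X t) * h t \<partial>M) = (\<integral>t. indicator B (X t) * Re (- \<i> * h t) \<partial>M)"
    by (subst integral_Im[OF int, symmetric]) (auto intro!: Bochner_Integration.integral_cong simp: indicator_def)
  moreover have "(\<integral>t. indicator B (X t) * Re (- \<i> * h t) \<partial>M) = 0"
  proof (rule Re0)
    show "integrable M (\<lambda>t. - \<i> * h t)" using h by simp
    have "(\<integral>t. iexp (y * X t) * (- \<i> * h t) \<partial>M) = (\<integral>t. - \<i> * (iexp (y * X t) * h t) \<partial>M)" for y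
      by (intro Bochner_Integration.integral_cong) (auto simp: mult_ac)
    then show "(\<integral>t. iexp (y * X t) * (- \<i> * h t) \<partial>M) = 0" for y
      using zero[of y] by (simp only: integral_mult_right_zero) simp
  qed
  ultimately show ?thesis using Re0[OF h zero] by (simp add: complex_eq_iff)
qed

text \<open>Only the distribution of \<open>X\<close> weighted by \<open>h\<close> is determined,
  not \<open>h\<close> itself; this is the form that can be iterated over the coordinates.\<close>

lemma uniqueness_one_dimensional:
  fixes \<psi> :: "real \<Rightarrow> real" and h :: "'a \<Rightarrow> complex" and X :: "'a \<Rightarrow> real"
  assumes nonneg: "\<And>x. 0 \<le> x \<Longrightarrow> 0 \<le> \<psi> x"
    and incr: "mono_on {0..} \<psi>"
    and lim: "filterlim \<psi> at_top at_top"
    and I: "(\<integral>\<^sup>+x\<in>{0..}. ennreal (\<psi> x / (1 + x\<^sup>2)) \<partial>lborel) = \<infinity>"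
    and h: "integrable M h" and X [measurable]: "X \<in> borel_measurable M"
    and tail: "\<And>s. 0 \<le> s \<Longrightarrow> (\<integral>t. (if s \<le> \<bar>X t\<bar> then cmod (h t) else 0) \<partial>M) \<le> K * exp (- \<psi> s)"
    and S: "closed S" "0 < emeasure lborel S"
    and zero: "\<And>y. y \<in> S \<Longrightarrow> (\<integral>t. iexp (y * X t) * h t \<partial>M) = 0"
    and B: "B \<in> sets borel"
  shows "(\<integral>t. indicator B (X t) * h t \<partial>M) = 0"
proof -
  obtain A where A: "\<And>k. 0 < A k" "\<And>k. A k \<le> A (Suc k)" "\<And>k. 2 ^ k \<le> \<psi> (A k)"
    "\<not> summable (\<lambda>k. 2 ^ k / A k)"
    using divergent_levels[OF nonneg incr lim I] by metis
  have "(\<integral>t. cmod (h t) \<partial>M) = (\<integral>t. (if 0 \<le> \<bar>X t\<bar> then cmod (h t) else 0) \<partial>M)" by simp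
  also have "\<dots> \<le> K * exp (- \<psi> 0)" using tail[of 0] by simp
  finally have K1: "(\<integral>t. cmod (h t) \<partial>M) \<le> K * exp (- \<psi> 0)" .
  have "0 \<le> K * exp (- \<psi> 0)" by (rule order_trans[OF Bochner_Integration.integral_nonneg K1]) auto
  then have K0: "0 \<le> K" by (simp add: zero_le_mult_iff)
  have K: "(\<integral>t. cmod (h t) \<partial>M) \<le> K"
    using K1 mult_left_le[of "exp (- \<psi> 0)" K] nonneg[of 0] K0 by auto
  have tailA: "(\<integral>t. (if A k \<le> \<bar>X t\<bar> then cmod (h t) else 0) \<partial>M) \<le> K * exp (- (2 ^ k))" for k
    using tail[of "A k"] A(1)[of k] A(3)[of k] K0 by (smt (verit) exp_le_cancel_iff mult_left_mono)
  \<comment> \<open>Some bounded piece of \<open>S\<close> has positive measure, since countably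
    many null pieces would make \<open>S\<close> null.\<close>
  obtain m :: nat where m: "0 < emeasure lborel (S \<inter> {- real (Suc m)..real (Suc m)})"
  proof (rule ccontr)
    assume "\<not> thesis"
    then have "emeasure lborel (S \<inter> {- real (Suc m)..real (Suc m)}) = 0" for m
      using that by (auto simp: zero_less_iff_neq_zero)
    then have "emeasure lborel (\<Union>m. S \<inter> {- real (Suc m)..real (Suc m)}) = 0"
      using S(1) by (intro emeasure_UN_eq_0) auto
    also have "(\<Union>m. S \<inter> {- real (Suc m)..real (Suc m)}) = S"
    proof (intro equalityI subsetI)
      fix x assume "x \<in> S"
      moreover obtain m where "\<bar>x\<bar> \<le> real m" using real_arch_simple by blast
      ultimately show "x \<in> (\<Union>m. S \<inter> {- real (Suc m)..real (Suc m)})" by (intro UN_I[of m]) auto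
    qed auto
    finally show False using S(2) by simp
  qed
  define b where "b = real (Suc m)"
  have far: "(\<integral>t. iexp (y * X t) * h t \<partial>M) = 0" if "b \<le> y" for y
    using transform_vanishes_beyond[OF h X K tailA A(1,2,4) S(1) _ m zero] that by (simp add: b_def)
  have "(\<integral>t. iexp (y * X t) * h t \<partial>M) = 0" for y
  proof -
    \<comment> \<open>The second run uses \<open>- X\<close>, whose transform vanishes on
      \<open>{..- b}\<close>. The choice of \<open>b'\<close> puts \<open>[b' - 1, b']\<close>
      inside that half-line and \<open>- y\<close> to the right of \<open>b'\<close>.\<close>
    define b' where "b' = min (- b) (- y)"
    have "(\<integral>t. iexp ((- y) * - X t) * h t \<partial>M) = 0"
    proof (rule transform_vanishes_beyond[OF h _ K _ A(1,2,4), of "\<lambda>t. - X t" "{..- b}" "b' - 1" b'])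
      have "{..- b} \<inter> {b' - 1..b'} = {b' - 1..b'}" by (auto simp: b'_def)
      then show "0 < emeasure lborel ({..- b} \<inter> {b' - 1..b'})" by simp
      show "(\<integral>t. iexp (z * - X t) * h t \<partial>M) = 0" if "z \<in> {..- b}" for z
        using far[of "- z"] that by simp
    qed (use tailA in \<open>auto simp: b'_def\<close>)
    then show ?thesis by simp
  qed
  then show ?thesis by (rule integral_indicator_eq_0[OF h X _ B])
qed

section \<open>The divergent case\<close>

text \<open>The average of the density over a set of positive variation is the value of \<mu>
  divided by the variation of that set, hence lies in the closed unit disc; the averaging theorem
  passes this on to almost every value.\<close>

lemma polar_density_norm_le_1:
  assumes cm: "complex_measure M \<mu>" and fin: "emeasure (total_variation M \<mu>) (space M) < \<infinity>"
  shows "AE x in total_variation M \<mu>. cmod (polar_density M \<mu> x) \<le> 1"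
proof -
  let ?V = "total_variation M \<mu>"
  interpret V: finite_measure ?V by (rule finite_measureI) (use fin in auto)
  have "AE x in ?V. polar_density M \<mu> x \<in> cball 0 1"
  proof (rule V.averaging_theorem)
    show "integrable ?V (polar_density M \<mu>)" by (rule polar_density_density(1)[OF cm fin])
    fix A assume A: "A \<in> sets ?V" "0 < measure ?V A"
    have "cmod (LINT x:A|?V. polar_density M \<mu> x) \<le> measure ?V A"
      using norm_le_total_variation[OF cm, of A] polar_density_density(2)[OF cm fin, of A] A
      by (simp add: V.emeasure_eq_measure)
    then show "(1 / measure ?V A) *\<^sub>R (LINT x:A|?V. polar_density M \<mu> x) \<in> cball 0 1"
      using A by (simp add: field_simps)
  qed simp
  then show ?thesis by eventually_elim simp
qed

text \<open>Markov's inequality for \<open>exp (\<psi> (\<rho> x))\<close>; by monotonicity this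
  function is at least \<open>exp (\<psi> s)\<close> where \<open>s \<le> \<rho> x\<close>.\<close>

lemma exponential_tail_bound:
  fixes \<psi> :: "real \<Rightarrow> real" and \<rho> :: "'a \<Rightarrow> real"
  assumes incr: "mono_on {0..} \<psi>" and [measurable]: "\<rho> \<in> borel_measurable M" and \<rho>: "\<And>x. 0 \<le> \<rho> x"
    and fin: "(\<integral>\<^sup>+x. ennreal (exp (\<psi> (\<rho> x))) \<partial>M) < \<infinity>" and s: "0 \<le> s"
  shows "measure M {x \<in> space M. s \<le> \<rho> x} \<le> enn2real (\<integral>\<^sup>+x. ennreal (exp (\<psi> (\<rho> x))) \<partial>M) * exp (- \<psi> s)"
proof -
  let ?S = "{x \<in> space M. s \<le> \<rho> x}"
  let ?I = "\<integral>\<^sup>+x. ennreal (exp (\<psi> (\<rho> x))) \<partial>M"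
  have "ennreal (exp (\<psi> s)) * emeasure M ?S = (\<integral>\<^sup>+x. ennreal (exp (\<psi> s)) * indicator ?S x \<partial>M)"
    by (subst nn_integral_cmult_indicator) auto
  also have "\<dots> \<le> ?I"
  proof (rule nn_integral_mono)
    fix x
    show "ennreal (exp (\<psi> s)) * indicator ?S x \<le> ennreal (exp (\<psi> (\<rho> x)))"
      using mono_onD[OF incr, of s "\<rho> x"] s \<rho>[of x] by (auto simp: indicator_def intro!: ennreal_leI)
  qed
  finally have "enn2real (ennreal (exp (\<psi> s)) * emeasure M ?S) \<le> enn2real ?I"
    by (rule enn2real_mono) (use fin in simp)
  then have "exp (\<psi> s) * measure M ?S \<le> enn2real ?I"
    by (simp add: enn2real_mult measure_def)
  then show ?thesis by (simp add: exp_minus field_simps)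
qed

text \<open>
  For fixed \<open>l\<close>, the remaining exponentials are absorbed into the density and the one-dimensional
  theorem is applied to a single coordinate; this turns the characters \<open>exp (- \<i> * l $ j * x $ j)\<close>
  into indicator functions one coordinate at a time.
\<close>

lemma mixed_integral_eq_0:
  fixes \<psi> :: "real \<Rightarrow> real" and V :: "(real ^ 'n) measure" and g :: "real ^ 'n \<Rightarrow> complex"
    and \<Lambda> E :: "'n \<Rightarrow> real set"
  assumes nonneg: "\<And>x. 0 \<le> x \<Longrightarrow> 0 \<le> \<psi> x"
    and incr: "mono_on {0..} \<psi>"
    and lim: "filterlim \<psi> at_top at_top"
    and I: "(\<integral>\<^sup>+x\<in>{0..}. ennreal (\<psi> x / (1 + x\<^sup>2)) \<partial>lborel) = \<infinity>"
    and V: "finite_measure V" and sets_V [measurable_cong]: "sets V = sets borel"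
    and fin: "(\<integral>\<^sup>+x. ennreal (exp (\<psi> (norm x))) \<partial>V) < \<infinity>"
    and [measurable]: "g \<in> borel_measurable borel" and g1: "\<And>x. cmod (g x) \<le> 1"
    and \<Lambda>: "\<And>j. closed (\<Lambda> j)" "\<And>j. 0 < emeasure lborel (\<Lambda> j)"
    and zero: "\<And>l. (\<And>j. l $ j \<in> \<Lambda> j) \<Longrightarrow> (\<integral>x. exp (- (\<i> * of_real (l \<bullet> x))) * g x \<partial>V) = 0"
    and E: "\<And>j. E j \<in> sets borel" and J: "finite J"
    and l: "\<And>j. l $ j \<in> \<Lambda> j"
  shows "(\<integral>x. (\<Prod>j\<in>J. indicator (E j) (x $ j)) * (\<Prod>j\<in>- J. exp (- (\<i> * of_real (l $ j * x $ j)))) * g x \<partial>V) = 0"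
  using J l
proof (induction J arbitrary: l rule: finite_induct)
  case empty
  have "exp (- (\<i> * of_real (l \<bullet> x))) = (\<Prod>j\<in>UNIV. exp (- (\<i> * of_real (l $ j * x $ j))))" for x
    by (simp add: inner_vec_def exp_sum[symmetric] sum_distrib_left sum_negf)
  then show ?case using zero[of l] empty by simp
next
  case (insert i J)
  interpret V: finite_measure V by (rule V)
  define h where "h = (\<lambda>x. (\<Prod>j\<in>J. indicator (E j) (x $ j)) *
    (\<Prod>j\<in>- insert i J. exp (- (\<i> * of_real (l $ j * x $ j)))) * g x)"
  have [measurable]: "Measurable.pred borel (\<lambda>x. x \<in> E j)" for j using E[of j] by simp
  have [measurable]: "h \<in> borel_measurable borel" unfolding h_def by measurable
  have ind1: "cmod (\<Prod>j\<in>J. indicator (E j) (x $ j)) \<le> 1" for x :: "real ^ 'n"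
    unfolding prod_norm[symmetric] by (rule prod_le_1) (auto simp: indicator_def)
  have exp1: "cmod (\<Prod>j\<in>K. exp (- (\<i> * of_real (l $ j * x $ j)))) = 1" for x :: "real ^ 'n" and K
    unfolding prod_norm[symmetric] by (rule prod.neutral) (simp add: norm_exp_i_times del: of_real_mult)
  have h1: "cmod (h x) \<le> 1" for x
    unfolding h_def norm_mult exp1 using ind1[of x] g1[of x] by (simp add: mult_le_one)
  have hint: "integrable V h"
    by (rule V.integrable_const_bound[of _ 1]) (use h1 in auto)
  define K where "K = enn2real (\<integral>\<^sup>+x. ennreal (exp (\<psi> (norm x))) \<partial>V)"
  \<comment> \<open>The characters carry a minus sign, so the one-dimensional theorem is applied to
    \<open>- (x $ i)\<close>, and \<open>E i\<close> is reflected to compensate.\<close>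
  have "(\<integral>x. indicator (uminus -` E i) (- (x $ i)) * h x \<partial>V) = 0"
  proof (rule uniqueness_one_dimensional[OF nonneg incr lim I hint _ _ \<Lambda>(1)[of i] \<Lambda>(2)[of i]])
    show "(\<lambda>x. - (x $ i)) \<in> borel_measurable V"
      unfolding measurable_cong_sets[OF sets_V refl]
      by (intro borel_measurable_continuous_onI continuous_intros)
  next
    fix s :: real assume s: "0 \<le> s"
    \<comment> \<open>A coordinate is bounded by the norm, so the tail in one coordinate is
      controlled by the tail of the whole measure.\<close>
    have "(\<integral>x. (if s \<le> \<bar>- (x $ i)\<bar> then cmod (h x) else 0) \<partial>V) \<le> (\<integral>x. indicator {x \<in> space V. s \<le> norm x} x \<partial>V)"
    proof (rule Bochner_Integration.integral_mono)
      show "integrable V (\<lambda>x. if s \<le> \<bar>- (x $ i)\<bar> then cmod (h x) else 0)"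
        by (rule V.integrable_const_bound[of _ 1]) (use h1 in auto)
      show "integrable V (indicat_real {x \<in> space V. s \<le> norm x})"
        by (intro integrable_real_indicator) (auto simp: V.emeasure_eq_measure)
      fix x assume "x \<in> space V"
      then show "(if s \<le> \<bar>- (x $ i)\<bar> then cmod (h x) else 0) \<le> indicator {x \<in> space V. s \<le> norm x} x"
        using h1[of x] component_le_norm_cart[of x i] by (auto simp: indicator_def)
    qed
    also have "\<dots> = measure V {x \<in> space V. s \<le> norm x}" by simp
    also have "\<dots> \<le> K * exp (- \<psi> s)"
      unfolding K_def by (rule exponential_tail_bound[OF incr _ _ fin s]) auto
    finally show "(\<integral>x. (if s \<le> \<bar>- (x $ i)\<bar> then cmod (h x) else 0) \<partial>V) \<le> K * exp (- \<psi> s)" .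
  next
    fix y assume y: "y \<in> \<Lambda> i"
    \<comment> \<open>The induction hypothesis holds at every point of the product, so the
      \<open>i\<close>-th coordinate may run through \<open>\<Lambda> i\<close> while the others
      stay fixed; this gives the zeros of the one-dimensional transform.\<close>
    define l' where "l' = (\<chi> j. if j = i then y else l $ j)"
    have l'i: "l' $ i = y" and l'j: "\<And>j. j \<noteq> i \<Longrightarrow> l' $ j = l $ j" by (simp_all add: l'_def)
    have "(\<integral>x. (\<Prod>j\<in>J. indicator (E j) (x $ j)) * (\<Prod>j\<in>- J. exp (- (\<i> * of_real (l' $ j * x $ j)))) * g x \<partial>V) = 0"
    proof (rule insert.IH)
      show "l' $ j \<in> \<Lambda> j" for j using insert.prems[of j] y by (auto simp: l'_def)
    qed
    moreover have "(\<Prod>j\<in>- J. exp (- (\<i> * of_real (l' $ j * x $ j))))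
        = iexp (y * - (x $ i)) * (\<Prod>j\<in>- insert i J. exp (- (\<i> * of_real (l $ j * x $ j))))" for x :: "real ^ 'n"
    proof -
      have "- J = insert i (- insert i J)" using insert.hyps by auto
      then have "(\<Prod>j\<in>- J. exp (- (\<i> * of_real (l' $ j * x $ j))))
        = exp (- (\<i> * of_real (l' $ i * x $ i))) * (\<Prod>j\<in>- insert i J. exp (- (\<i> * of_real (l' $ j * x $ j))))"
        by (metis (no_types, lifting) Compl_iff finite insertI1 prod.insert)
      also have "(\<Prod>j\<in>- insert i J. exp (- (\<i> * of_real (l' $ j * x $ j))))
        = (\<Prod>j\<in>- insert i J. exp (- (\<i> * of_real (l $ j * x $ j))))"
        by (rule prod.cong) (auto simp: l'j)
      finally show ?thesis by (simp add: l'i)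
    qed
    ultimately show "(\<integral>x. iexp (y * - (x $ i)) * h x \<partial>V) = 0"
      unfolding h_def by (simp only: mult_ac)
  next
    show "uminus -` E i \<in> sets borel"
      using measurable_sets[of uminus borel borel "E i"] E[of i] by simp
  qed simp
  moreover have "indicator (uminus -` E i) (- (x $ i)) * h x = (\<Prod>j\<in>insert i J. indicator (E j) (x $ j)) *
    (\<Prod>j\<in>- insert i J. exp (- (\<i> * of_real (l $ j * x $ j)))) * g x" for x
    using insert.hyps by (simp add: h_def indicator_def)
  ultimately show ?case by simp
qed

text \<open>The sets \<open>{..a}\<close> are boxes, stable under intersection, and generate the
  Borel sets, so Dynkin's theorem applies. The whole space is a box as well, which settles
  complements.\<close>

lemma complex_measure_eq_0I:
  fixes \<mu> :: "(real ^ 'n) set \<Rightarrow> complex"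
  assumes cm: "complex_measure borel \<mu>"
    and boxes: "\<And>E. (\<And>j. E j \<in> sets borel) \<Longrightarrow> \<mu> {x. \<forall>j. x $ j \<in> E j} = 0"
    and S: "S \<in> sets borel"
  shows "\<mu> S = 0"
proof -
  have borel: "sets borel = sigma_sets UNIV (range (\<lambda>a::real ^ 'n. {..a}))"
    by (subst borel_eq_atMost) simp
  have UNIV0: "\<mu> UNIV = 0" using boxes[of "\<lambda>_. UNIV"] by simp
  have add: "\<mu> (A \<union> B) = \<mu> A + \<mu> B" if "A \<in> sets borel" "B \<in> sets borel" "A \<inter> B = {}" for A B
  proof -
    have "range (binaryset A B) \<subseteq> sets borel" "disjoint_family (binaryset A B)"
      using that by (auto simp: binaryset_def disjoint_family_on_def)
    then have "(\<lambda>i. \<mu> (binaryset A B i)) sums \<mu> (\<Union>i. binaryset A B i)"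
      using cm by (simp add: complex_measure_def)
    moreover have "(\<lambda>i. \<mu> (binaryset A B i)) sums (\<mu> A + \<mu> B)"
      by (rule binaryset_sums) (rule complex_measure_empty[OF cm])
    ultimately show ?thesis using sums_unique2 by (metis UN_binaryset_eq)
  qed
  have "Int_stable (range (\<lambda>a::real ^ 'n. {..a}))"
  proof (rule Int_stableI_image)
    fix a b :: "real ^ 'n"
    show "\<exists>c\<in>UNIV. {..a} \<inter> {..b} = {..c}"
      by (rule bexI[of _ "\<chi> j. min (a $ j) (b $ j)"]) (auto simp: less_eq_vec_def)
  qed
  moreover have "S \<in> sigma_sets UNIV (range (\<lambda>a::real ^ 'n. {..a}))" using S borel by simp
  ultimately show ?thesis
  proof (induction rule: sigma_sets_induct_disjoint[OF _ subset_trans[OF subset_UNIV Pow_UNIV[THEN equalityD2]], consumes 2, case_names basic empty compl union])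
    case (basic A)
    then obtain a where "A = {..a}" by blast
    also have "\<dots> = {x. \<forall>j. x $ j \<in> {..a $ j}}" by (auto simp: less_eq_vec_def)
    finally show ?case using boxes[of "\<lambda>j. {..a $ j}"] by simp
  next
    case empty
    show ?case by (rule complex_measure_empty[OF cm])
  next
    case (compl A)
    then have A: "A \<in> sets borel" using borel by simp
    then have "\<mu> (A \<union> (UNIV - A)) = \<mu> A + \<mu> (UNIV - A)" by (intro add) auto
    then show ?case using UNIV0 compl by (simp add: Un_Diff_cancel)
  next
    case (union A)
    then have "range A \<subseteq> sets borel" using borel by simp
    then have "(\<lambda>i. \<mu> (A i)) sums \<mu> (\<Union>i. A i)"
      using union.hyps(1) cm[unfolded complex_measure_def] by blast
    then show ?case unfolding union.IH using sums_unique2[OF _ sums_zero] by blast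
  qed
qed

theorem complex_measure_eq_0_of_divergent:
  fixes \<psi> :: "real \<Rightarrow> real" and \<mu> :: "(real ^ 'n) set \<Rightarrow> complex" and \<Lambda> :: "'n \<Rightarrow> real set"
  assumes nonneg: "\<And>x. 0 \<le> x \<Longrightarrow> 0 \<le> \<psi> x"
    and incr: "mono_on {0..} \<psi>"
    and lim: "filterlim \<psi> at_top at_top"
    and I: "(\<integral>\<^sup>+x\<in>{0..}. ennreal (\<psi> x / (1 + x\<^sup>2)) \<partial>lborel) = \<infinity>"
    and cm: "complex_measure borel \<mu>"
    and fin: "(\<integral>\<^sup>+x. ennreal (exp (\<psi> (norm x))) \<partial>total_variation borel \<mu>) < \<infinity>"
    and \<Lambda>: "\<And>j. closed (\<Lambda> j)" "\<And>j. 0 < emeasure lborel (\<Lambda> j)"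
    and zero: "\<And>l. (\<And>j. l $ j \<in> \<Lambda> j) \<Longrightarrow> fourier_transform \<mu> l = 0"
    and S: "S \<in> sets borel"
  shows "\<mu> S = 0"
proof (rule complex_measure_eq_0I[OF cm _ S])
  fix E :: "'n \<Rightarrow> real set" assume E: "\<And>j. E j \<in> sets borel"
  let ?V = "total_variation borel \<mu>"
  \<comment> \<open>As \<open>exp (\<psi> (norm x)) \<ge> 1\<close>, exponential integrability makes
    the total variation finite, as the results on the polar density require.\<close>
  have "emeasure ?V (space borel) = (\<integral>\<^sup>+x. 1 \<partial>?V)" by simp
  also have "\<dots> \<le> (\<integral>\<^sup>+x. ennreal (exp (\<psi> (norm x))) \<partial>?V)"
    by (rule nn_integral_mono) (use nonneg in auto)
  finally have Vfin: "emeasure ?V (space borel) < \<infinity>" using fin by (rule le_less_trans)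
  then have V: "finite_measure ?V" by (intro finite_measureI) auto
  define p where "p = polar_density borel \<mu>"
  have [measurable]: "p \<in> borel_measurable borel"
    using borel_measurable_integrable[OF polar_density_density(1)[OF cm Vfin]] by (simp add: p_def)
  \<comment> \<open>The polar density is bounded by 1 only almost everywhere; this version is
    bounded everywhere and has the same integrals.\<close>
  define g where "g = (\<lambda>x. if cmod (p x) \<le> 1 then p x else 0)"
  have [measurable]: "g \<in> borel_measurable borel" unfolding g_def by measurable
  have pg: "AE x in ?V. p x = g x"
    using polar_density_norm_le_1[OF cm Vfin] by eventually_elim (simp add: g_def p_def)
  have cong: "(\<integral>x. F x * p x \<partial>?V) = (\<integral>x. F x * g x \<partial>?V)" if [measurable]: "F \<in> borel_measurable borel" for F
    by (rule integral_cong_AE) (use pg in auto)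
  \<comment> \<open>Any point of the product serves: once all coordinates are treated, the product
    of characters is empty.\<close>
  obtain l where l: "\<And>j. l $ j \<in> \<Lambda> j"
  proof -
    have "\<exists>y. y \<in> \<Lambda> j" for j using \<Lambda>(2)[of j] by (cases "\<Lambda> j = {}") auto
    then obtain f where "\<And>j. f j \<in> \<Lambda> j" by metis
    then show thesis using that[of "\<chi> j. f j"] by simp
  qed
  have "(\<integral>x. (\<Prod>j\<in>UNIV. indicator (E j) (x $ j)) * (\<Prod>j\<in>- UNIV. exp (- (\<i> * of_real (l $ j * x $ j)))) * g x \<partial>?V) = 0"
  proof (rule mixed_integral_eq_0[OF nonneg incr lim I V _ fin _ _ \<Lambda> _ E _ l])
    fix l :: "real ^ 'n" assume "\<And>j. l $ j \<in> \<Lambda> j"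
    then show "(\<integral>x. exp (- (\<i> * of_real (l \<bullet> x))) * g x \<partial>?V) = 0"
      using zero[of l] by (subst cong[symmetric]) (simp_all add: fourier_transform_def complex_measure_integral_def p_def)
  qed (auto simp: g_def)
  moreover have "(\<Prod>j\<in>UNIV. indicator (E j) (x $ j)) = (indicator {x. \<forall>j. x $ j \<in> E j} x :: complex)" for x
    by (auto simp: indicator_def)
  ultimately have 0: "(\<integral>x. indicator {x. \<forall>j. x $ j \<in> E j} x * g x \<partial>?V) = 0" by simp
  have [measurable]: "Measurable.pred borel (\<lambda>x. x \<in> E j)" for j using E[of j] by simp
  have box: "{x::real ^ 'n. \<forall>j. x $ j \<in> E j} \<in> sets borel" by measurable
  then have "\<mu> {x. \<forall>j. x $ j \<in> E j} = (\<integral>x. indicator {x. \<forall>j. x $ j \<in> E j} x * p x \<partial>?V)"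
    unfolding p_def polar_density_density(2)[OF cm Vfin box] set_lebesgue_integral_def
    by (intro Bochner_Integration.integral_cong) (auto simp: indicator_def)
  also have "\<dots> = 0" using 0 cong[OF borel_measurable_indicator[OF box]] by simp
  finally show "\<mu> {x. \<forall>j. x $ j \<in> E j} = 0" .
qed

section \<open>The convergent case\<close>

lemma complex_measure_density:
  fixes s :: "'a \<Rightarrow> complex"
  assumes s: "integrable M s"
  shows "complex_measure M (\<lambda>E. LINT x:E|M. s x)"
  unfolding complex_measure_def
proof (intro allI impI)
  fix A :: "nat \<Rightarrow> 'a set" assume A: "range A \<subseteq> sets M" "disjoint_family A"
  then have [measurable]: "A i \<in> sets M" for i by auto
  have [measurable]: "s \<in> borel_measurable M" using s by auto
  have "(\<lambda>n. \<integral>x. indicator (\<Union>i<n. A i) x *\<^sub>R s x \<partial>M) \<longlonglongrightarrow> (\<integral>x. indicator (\<Union>i. A i) x *\<^sub>R s x \<partial>M)"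
  proof (rule integral_dominated_convergence[where w = "\<lambda>x. norm (s x)"])
    show "AE x in M. (\<lambda>n. indicator (\<Union>i<n. A i) x *\<^sub>R s x) \<longlonglongrightarrow> indicator (\<Union>i. A i) x *\<^sub>R s x"
      by (intro AE_I2 tendsto_intros LIMSEQ_indicator_UN)
  qed (use s in \<open>auto simp: indicator_def\<close>)
  moreover have "(\<integral>x. indicator (\<Union>i<n. A i) x *\<^sub>R s x \<partial>M) = (\<Sum>i<n. LINT x:A i|M. s x)" for n
  proof -
    have "(LINT x:(\<Union>i\<in>{..<n}. A i)|M. s x) = (\<Sum>i\<in>{..<n}. LINT x:A i|M. s x)"
      using A s by (intro set_integral_finite_Union)
        (auto simp: disjoint_family_on_def set_integrable_def intro!: integrable_mult_indicator)
    then show ?thesis by (simp add: set_lebesgue_integral_def)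
  qed
  ultimately show "(\<lambda>i. LINT x:A i|M. s x) sums (LINT x:(\<Union>i. A i)|M. s x)"
    by (simp add: sums_def set_lebesgue_integral_def)
qed

lemma total_variation_density_le:
  fixes s :: "'a \<Rightarrow> complex"
  assumes s: "integrable M s" and E: "E \<in> sets M"
  shows "emeasure (total_variation M (\<lambda>E. LINT x:E|M. s x)) E \<le> (\<integral>\<^sup>+x\<in>E. ennreal (cmod (s x)) \<partial>M)"
  unfolding emeasure_total_variation[OF complex_measure_density[OF s] E]
proof (rule SUP_least)
  fix A assume "A \<in> countable_partitions M E"
  then have A: "range A \<subseteq> sets M" "disjoint_family A" "(\<Union>i. A i) = E"
    by (auto simp: countable_partitions_def)
  then have [measurable]: "A i \<in> sets M" for i by auto
  have [measurable]: "s \<in> borel_measurable M" using s by auto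
  have "(\<Sum>i. ennreal (cmod (LINT x:A i|M. s x))) \<le> (\<Sum>i. \<integral>\<^sup>+x\<in>A i. ennreal (cmod (s x)) \<partial>M)"
  proof (intro suminf_le summableI)
    fix i
    have "ennreal (cmod (LINT x:A i|M. s x)) \<le> (\<integral>\<^sup>+x. ennreal (cmod (indicator (A i) x *\<^sub>R s x)) \<partial>M)"
      unfolding set_lebesgue_integral_def
      by (intro integral_norm_bound_ennreal integrable_mult_indicator s) simp
    also have "\<dots> = (\<integral>\<^sup>+x\<in>A i. ennreal (cmod (s x)) \<partial>M)"
      by (intro nn_integral_cong) (auto simp: indicator_def)
    finally show "ennreal (cmod (LINT x:A i|M. s x)) \<le> (\<integral>\<^sup>+x\<in>A i. ennreal (cmod (s x)) \<partial>M)" .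
  qed
  also have "\<dots> = (\<integral>\<^sup>+x\<in>(\<Union>i. A i). ennreal (cmod (s x)) \<partial>M)"
    by (rule nn_integral_disjoint_family[symmetric]) (use A in auto)
  finally show "(\<Sum>i. ennreal (cmod (LINT x:A i|M. s x))) \<le> (\<integral>\<^sup>+x\<in>E. ennreal (cmod (s x)) \<partial>M)"
    by (simp add: A)
qed

text \<open>The total variation has a density \<open>D\<close> with respect to \<open>M\<close>, and
  \<open>D\<close> times the polar density represents the same complex measure as \<open>s\<close>,
  so the two agree almost everywhere. The total variation itself is never computed: an upper bound
  gives its finiteness and absolute continuity.\<close>

lemma complex_measure_integral_density:
  fixes s g :: "'a \<Rightarrow> complex"
  assumes M: "sigma_finite_measure M" and s: "integrable M s" and [measurable]: "g \<in> borel_measurable M"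
  shows "complex_measure_integral M (\<lambda>E. LINT x:E|M. s x) g = (\<integral>x. g x * s x \<partial>M)"
proof -
  interpret M: sigma_finite_measure M by (rule M)
  define \<mu> where "\<mu> = (\<lambda>E. LINT x:E|M. s x)"
  let ?V = "total_variation M \<mu>"
  note cm = complex_measure_density[OF s, folded \<mu>_def]
  have [measurable]: "s \<in> borel_measurable M" using s by auto
  have le: "emeasure ?V E \<le> (\<integral>\<^sup>+x\<in>E. ennreal (cmod (s x)) \<partial>M)" if "E \<in> sets M" for E
    using total_variation_density_le[OF s that] by (simp add: \<mu>_def)
  have "emeasure ?V (space M) \<le> (\<integral>\<^sup>+x. ennreal (cmod (s x)) \<partial>M)"
    using le[of "space M"] by (simp cong: nn_integral_cong)
  also have "\<dots> < \<infinity>" using s by (simp add: integrable_iff_bounded)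
  finally have fin: "emeasure ?V (space M) < \<infinity>" .
  then have V: "finite_measure ?V" by (intro finite_measureI) auto
  have ac: "absolutely_continuous M ?V"
    unfolding absolutely_continuous_def
  proof
    fix E assume E: "E \<in> null_sets M"
    then have "(\<integral>\<^sup>+x\<in>E. ennreal (cmod (s x)) \<partial>M) = 0" by (rule nn_integral_null_set)
    then show "E \<in> null_sets ?V" using le[of E] E by (auto simp: null_sets_def)
  qed
  obtain D where [measurable]: "D \<in> borel_measurable M" and D: "AE x in M. RN_deriv M ?V x = ennreal (D x)"
    and D0: "\<And>x. 0 \<le> D x"
    using M.real_RN_deriv[OF V ac] by (metis sets_total_variation)
  have VD: "?V = density M D"
  proof -
    have "?V = density M (RN_deriv M ?V)" using M.density_RN_deriv[OF ac] by simp
    also have "\<dots> = density M D" by (rule density_cong) (use D in auto)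
    finally show ?thesis .
  qed
  define p where "p = polar_density M \<mu>"
  have p: "integrable ?V p" unfolding p_def by (rule polar_density_density(1)[OF cm fin])
  then have [measurable]: "p \<in> borel_measurable M"
    using borel_measurable_integrable[OF p] by simp
  have change: "(\<integral>x. F x \<partial>?V) = (\<integral>x. D x *\<^sub>R F x \<partial>M)" if [measurable]: "F \<in> borel_measurable M" for F :: "'a \<Rightarrow> complex"
    unfolding VD using D0 by (intro integral_density) auto
  have Dp: "integrable M (\<lambda>x. D x *\<^sub>R p x)"
    using p D0 unfolding VD by (subst (asm) integrable_density) auto
  have "AE x in M. D x *\<^sub>R p x = s x"
  proof (rule M.density_unique_banach[OF Dp s])
    fix A assume A [measurable]: "A \<in> sets M"
    have "(LINT x:A|M. D x *\<^sub>R p x) = (LINT x:A|?V. p x)"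
      unfolding set_lebesgue_integral_def by (subst change) (auto simp: mult.commute)
    also have "\<dots> = \<mu> A" unfolding p_def by (rule polar_density_density(2)[OF cm fin A, symmetric])
    finally show "(LINT x:A|M. D x *\<^sub>R p x) = (LINT x:A|M. s x)" by (simp add: \<mu>_def)
  qed
  then have ae: "AE x in M. D x *\<^sub>R (g x * p x) = g x * s x"
    by eventually_elim (metis mult_scaleR_right)
  have "complex_measure_integral M \<mu> g = (\<integral>x. g x * p x \<partial>?V)"
    by (simp add: complex_measure_integral_def p_def)
  also have "\<dots> = (\<integral>x. D x *\<^sub>R (g x * p x) \<partial>M)" by (rule change) simp
  also have "\<dots> = (\<integral>x. g x * s x \<partial>M)" by (rule integral_cong_AE) (use ae in auto)
  finally show ?thesis by (simp add: \<mu>_def)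
qed

section \<open>Analytic functions in the upper half-plane\<close>

lemma integrable_Cauchy_kernel: "integrable lborel (\<lambda>x::real. 1 / (1 + x\<^sup>2))"
  using integrable_inverse_1_plus_square by (simp add: set_integrable_def inverse_eq_divide)

text \<open>The segment from \<open>- r\<close> to \<open>r\<close> is closed by the upper
  semicircle, where \<open>cmod (z + \<i>) \<ge> r\<close>, so that the arc contributes at most
  \<open>pi / r\<close>. Holomorphy slightly below the real axis places the closed contour in an
  open convex set.\<close>

lemma integral_eq_0_of_upper_half_plane:
  fixes F :: "complex \<Rightarrow> complex"
  assumes hol: "F holomorphic_on {z. -1 < Im z}"
    and bound: "\<And>z. 0 \<le> Im z \<Longrightarrow> cmod (F z) \<le> 1 / (cmod (z + \<i>))\<^sup>2"
  shows "(\<integral>x. F (of_real x) \<partial>lborel) = 0"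
proof -
  have cont: "continuous_on UNIV (\<lambda>x::real. F (of_real x))"
    by (rule continuous_on_compose2[OF holomorphic_on_imp_continuous_on[OF hol]]) (auto intro!: continuous_intros)
  have [measurable]: "(\<lambda>x::real. F (of_real x)) \<in> borel_measurable borel"
    by (rule borel_measurable_continuous_onI[OF cont])
  have Fx: "cmod (F (of_real x)) \<le> 1 / (1 + x\<^sup>2)" for x :: real
    using bound[of "of_real x"] by (simp add: cmod_power2 add.commute)
  have half: "cmod (\<integral>x. indicator {- r..r} x *\<^sub>R F (of_real x) \<partial>lborel) \<le> pi / r" if r: "0 < r" for r :: real
  proof -
    let ?c = "part_circlepath 0 r 0 pi" and ?l = "linepath (complex_of_real (- r)) (complex_of_real r)"
    have ends: "pathfinish ?l = pathstart ?c" "pathfinish ?c = pathstart ?l"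
      by (simp_all add: exp_Euler)
    have circ: "Im z \<ge> 0 \<and> cmod z = r" if "z \<in> path_image ?c" for z
      using that r by (auto simp: path_image_part_circlepath' exp_Euler sin_ge_zero norm_mult cos_of_real sin_of_real
          closed_segment_eq_real_ivl intro!: mult_nonneg_nonneg)
    have line: "Im z = 0" if "z \<in> path_image ?l" for z
      using that by (auto simp: closed_segment_def)
    have conv: "convex {z. -1 < Im z}" by (rule convex_halfspace_Im_gt)
    have "(F has_contour_integral 0) (?l +++ ?c)"
    proof (rule Cauchy_theorem_convex_simple[OF hol conv])
      have "path_image (?l +++ ?c) \<subseteq> path_image ?l \<union> path_image ?c" by (rule path_image_join_subset)
      also have "\<dots> \<subseteq> {z. -1 < Im z}" using circ line by fastforce
      finally show "path_image (?l +++ ?c) \<subseteq> {z. -1 < Im z}" .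
    qed (use ends in \<open>auto intro!: valid_path_join\<close>)
    moreover have l: "F contour_integrable_on ?l"
      by (rule contour_integrable_continuous_linepath, rule continuous_on_subset[OF holomorphic_on_imp_continuous_on[OF hol]])
         (use line in fastforce)
    moreover have c: "F contour_integrable_on ?c"
      by (rule contour_integrable_continuous_part_circlepath, rule continuous_on_subset[OF holomorphic_on_imp_continuous_on[OF hol]])
         (use circ in fastforce)
    ultimately have "contour_integral ?l F + contour_integral ?c F = 0"
      using contour_integral_join[OF l c] contour_integral_unique[of F 0 "?l +++ ?c"] by simp
    then have "cmod (contour_integral ?l F) = cmod (contour_integral ?c F)"
      by (metis add_eq_0_iff norm_minus_cancel)
    also have "\<dots> \<le> (1 / r\<^sup>2) * r * (pi - 0)"
    proof (rule has_contour_integral_bound_part_circlepath[OF has_contour_integral_integral[OF c]])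
      fix z assume "z \<in> path_image ?c"
      then have z: "0 \<le> Im z" "cmod z = r" using circ by auto
      have "(cmod (z + \<i>))\<^sup>2 = (cmod z)\<^sup>2 + (2 * Im z + 1)" unfolding cmod_power2 by (simp add: power2_eq_square algebra_simps)
      then have "r\<^sup>2 \<le> (cmod (z + \<i>))\<^sup>2" using z by simp
      then have "1 / (cmod (z + \<i>))\<^sup>2 \<le> 1 / r\<^sup>2" using r by (intro frac_le) auto
      then show "cmod (F z) \<le> 1 / r\<^sup>2" using bound[OF z(1)] by linarith
    qed (use r in auto)
    also have "\<dots> = pi / r" using r by (simp add: power2_eq_square)
    also have "contour_integral ?l F = integral {- r..r} (\<lambda>x. F (of_real x))"
      using r contour_integral_linepath_Reals_eq[of "of_real (- r)" "of_real r" F] by simp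
    also have "\<dots> = (LINT x:{- r..r}|lborel. F (of_real x))"
      by (rule set_borel_integral_eq_integral(2)[symmetric])
         (intro borel_integrable_atLeastAtMost' continuous_on_subset[OF cont] subset_UNIV)
    finally show ?thesis by (simp add: set_lebesgue_integral_def)
  qed
  have lim: "(\<lambda>n. \<integral>x. indicator {- real n..real n} x *\<^sub>R F (of_real x) \<partial>lborel) \<longlonglongrightarrow> (\<integral>x. F (of_real x) \<partial>lborel)"
  proof (rule integral_dominated_convergence[OF _ _ integrable_Cauchy_kernel])
    show "AE x in lborel. (\<lambda>n. indicator {- real n..real n} x *\<^sub>R F (of_real x)) \<longlonglongrightarrow> F (of_real x)"
    proof (intro AE_I2 tendsto_eventually)
      fix x :: real
      obtain N where "\<bar>x\<bar> \<le> real N" using real_arch_simple by blast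
      then have "\<forall>n\<ge>N. indicator {- real n..real n} x *\<^sub>R F (of_real x) = F (of_real x)"
        by (auto simp: indicator_def)
      then show "\<forall>\<^sub>F n in sequentially. indicator {- real n..real n} x *\<^sub>R F (of_real x) = F (of_real x)"
        by (auto simp: eventually_at_top_linorder)
    qed
    show "AE x in lborel. norm (indicator {- real n..real n} x *\<^sub>R F (of_real x)) \<le> 1 / (1 + x\<^sup>2)" for n
      using Fx by (intro AE_I2) (auto simp: indicator_def)
  qed auto
  have "(\<lambda>n. \<integral>x. indicator {- real n..real n} x *\<^sub>R F (of_real x) \<partial>lborel) \<longlonglongrightarrow> 0"
  proof (rule Lim_null_comparison)
    show "\<forall>\<^sub>F n in sequentially. cmod (\<integral>x. indicator {- real n..real n} x *\<^sub>R F (of_real x) \<partial>lborel) \<le> pi / real n"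
      by (intro eventually_mono[OF eventually_gt_at_top[of "0::nat"]] half) simp
    show "(\<lambda>n. pi / real n) \<longlonglongrightarrow> 0" by (rule lim_const_over_n)
  qed
  with lim show ?thesis by (rule LIMSEQ_unique)
qed

lemma Re_ii_divide: "Re (\<i> / w) = Im w / (cmod w)\<^sup>2"
  by (simp add: Re_divide cmod_power2)

text \<open>An integral test: on the cell from \<open>k\<close> to \<open>k + 1\<close> monotonicity
  gives \<open>\<psi> k \<le> \<psi> x\<close>, and \<open>1 + x\<^sup>2\<close> is at most twice
  \<open>(1 + k)\<^sup>2\<close>.\<close>

lemma summable_of_convergent:
  fixes \<psi> :: "real \<Rightarrow> real"
  assumes nonneg: "\<And>x. 0 \<le> x \<Longrightarrow> 0 \<le> \<psi> x"
    and incr: "mono_on {0..} \<psi>"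
    and I: "(\<integral>\<^sup>+x\<in>{0..}. ennreal (\<psi> x / (1 + x\<^sup>2)) \<partial>lborel) < \<infinity>"
  shows "summable (\<lambda>k::nat. \<psi> k / (1 + real k)\<^sup>2)"
proof -
  have "(\<Sum>k. ennreal (\<psi> (real k) / (2 * (1 + real k)\<^sup>2)))
      = (\<Sum>k. \<integral>\<^sup>+x. ennreal (\<psi> (real k) / (2 * (1 + real k)\<^sup>2)) * indicator {real k..<real k + 1} x \<partial>lborel)"
    by (simp add: nn_integral_cmult_indicator)
  also have "\<dots> = (\<integral>\<^sup>+x. (\<Sum>k. ennreal (\<psi> (real k) / (2 * (1 + real k)\<^sup>2)) * indicator {real k..<real k + 1} x) \<partial>lborel)"
    by (rule nn_integral_suminf[symmetric]) auto
  also have "\<dots> \<le> (\<integral>\<^sup>+x\<in>{0..}. ennreal (\<psi> x / (1 + x\<^sup>2)) \<partial>lborel)"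
  proof (rule nn_integral_mono)
    fix x :: real
    show "(\<Sum>k. ennreal (\<psi> (real k) / (2 * (1 + real k)\<^sup>2)) * indicator {real k..<real k + 1} x)
       \<le> ennreal (\<psi> x / (1 + x\<^sup>2)) * indicator {0..} x"
    proof (cases "0 \<le> x")
      case True
      define m where "m = nat \<lfloor>x\<rfloor>"
      have m: "real m \<le> x" "x < real m + 1" using True by (auto simp: m_def)
      have "k = m" if "real k \<le> x" "x < real k + 1" for k using that m by linarith
      then have "(\<Sum>k. ennreal (\<psi> (real k) / (2 * (1 + real k)\<^sup>2)) * indicator {real k..<real k + 1} x)
        = (\<Sum>k\<in>{m}. ennreal (\<psi> (real k) / (2 * (1 + real k)\<^sup>2)) * indicator {real k..<real k + 1} x)"
        by (intro suminf_finite) (auto simp: indicator_def)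
      also have "\<dots> = ennreal (\<psi> (real m) / (2 * (1 + real m)\<^sup>2))"
        using m by (subst sum.insert) (auto simp: indicator_def)
      also have "\<dots> \<le> ennreal (\<psi> x / (1 + x\<^sup>2))"
      proof (intro ennreal_leI frac_le)
        show "\<psi> (real m) \<le> \<psi> x" using mono_onD[OF incr, of "real m" x] m True by auto
        have "x\<^sup>2 \<le> (1 + real m)\<^sup>2" using m True by (intro power_mono) auto
        moreover have "1 \<le> (1 + real m)\<^sup>2" by (rule one_le_power) simp
        ultimately show "1 + x\<^sup>2 \<le> 2 * (1 + real m)\<^sup>2" by linarith
        show "0 \<le> \<psi> x" by (rule nonneg[OF True])
        show "0 < 1 + x\<^sup>2" by (rule add_pos_nonneg) auto
      qed
      finally show ?thesis using True by simp
    next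
      case False
      then show ?thesis by (simp add: indicator_def)
    qed
  qed
  finally have "(\<Sum>k. ennreal (\<psi> (real k) / (2 * (1 + real k)\<^sup>2))) \<noteq> top" using I by auto
  then have "summable (\<lambda>k. \<psi> (real k) / (2 * (1 + real k)\<^sup>2))"
    using nonneg by (intro summable_suminf_not_top) auto
  from summable_mult[OF this, of 2] show ?thesis by simp
qed

text \<open>
  In the upper half-plane \<open>Re (\<i> / (z - k)) > 0\<close>, so every partial sum of the series below gives a
  bounded analytic factor; at height one above \<open>x\<close>, the term with \<open>k\<close> the ceiling of \<open>\<bar>x\<bar>\<close> alone
  contributes at least \<open>\<psi> \<bar>x\<bar> / 2\<close> to the real part.
\<close>

lemma rapidly_decreasing_one_sided_spectrum:
  fixes \<psi> :: "real \<Rightarrow> real"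
  assumes nonneg: "\<And>x. 0 \<le> x \<Longrightarrow> 0 \<le> \<psi> x"
    and incr: "mono_on {0..} \<psi>"
    and I: "(\<integral>\<^sup>+x\<in>{0..}. ennreal (\<psi> x / (1 + x\<^sup>2)) \<partial>lborel) < \<infinity>"
  obtains f :: "real \<Rightarrow> complex" where "f \<in> borel_measurable borel" "\<And>x. f x \<noteq> 0"
    "\<And>x. cmod (f x) \<le> exp (- \<psi> \<bar>x\<bar>) / (1 + x\<^sup>2)"
    "\<And>l. l \<le> 0 \<Longrightarrow> (\<integral>x. exp (- (\<i> * of_real (l * x))) * f x \<partial>lborel) = 0"
proof -
  \<comment> \<open>The poles at \<open>k\<close> and \<open>- k\<close> are paired for convergence:
    with \<open>w = z + \<i>\<close> the pair adds up to
    \<open>2 * \<i> * w / (w\<^sup>2 - k\<^sup>2)\<close>, of order \<open>1 / k\<^sup>2\<close>,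
    while a single term is only of order \<open>1 / k\<close>.\<close>
  define u where "u = (\<lambda>(k::nat) z. of_real (\<psi> k) * (\<i> / (z + \<i> - of_nat k) + \<i> / (z + \<i> + of_nat k)))"
  have re: "Re (\<i> / (z + \<i> - of_nat k)) \<ge> 0" "Re (\<i> / (z + \<i> + of_nat k)) \<ge> 0" if "-1 < Im z" for k z
    using that by (simp_all add: Re_ii_divide)
  have Re_u: "0 \<le> Re (u k z)" if "-1 < Im z" for k z
    using re[OF that, of k] nonneg[of "real k"] by (simp add: u_def)
  \<comment> \<open>The character is bounded by 1 in the upper half-plane because
    \<open>l \<le> 0\<close>; the square in the denominator supplies decay, and the factor 2 turns
    the gain of \<open>\<psi> \<bar>x\<bar> / 2\<close> into the full exponent.\<close>
  define F where "F = (\<lambda>N l z. exp (- (\<i> * of_real l * z)) * exp (- 2 * (\<Sum>k<N. u k z)) / (z + \<i>)\<^sup>2)"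
  have ne: "z + \<i> \<noteq> 0" "z + \<i> - of_nat k \<noteq> 0" "z + \<i> + of_nat k \<noteq> 0" if "-1 < Im z" for z and k :: nat
    using that by (auto simp: complex_eq_iff)
  have hol: "F N l holomorphic_on {z. -1 < Im z}" for N l
    unfolding F_def u_def by (intro holomorphic_intros) (use ne in auto)
  have bound: "cmod (F N l z) \<le> 1 / (cmod (z + \<i>))\<^sup>2" if z: "0 \<le> Im z" and l: "l \<le> 0" for N l z
  proof -
    have "0 \<le> (\<Sum>k<N. Re (u k z))" using Re_u z by (intro sum_nonneg) auto
    then have "cmod (exp (- 2 * (\<Sum>k<N. u k z))) \<le> 1" by simp
    moreover have "cmod (exp (- (\<i> * of_real l * z))) \<le> 1" using z l by (simp add: mult_nonpos_nonneg)
    ultimately have "cmod (exp (- (\<i> * of_real l * z)) * exp (- 2 * (\<Sum>k<N. u k z))) \<le> 1"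
      unfolding norm_mult by (intro mult_le_one) auto
    then show ?thesis unfolding F_def norm_divide norm_power by (intro divide_right_mono) auto
  qed
  have zero: "(\<integral>x. F N l (of_real x) \<partial>lborel) = 0" if "l \<le> 0" for N l
    using integral_eq_0_of_upper_half_plane[OF hol] bound that by blast
  have sm: "summable (\<lambda>k. u k (of_real x))" for x :: real
  proof (rule summable_comparison_test)
    define w where "w = complex_of_real x + \<i>"
    define C where "C = 2 * cmod w * (2 + cmod w)\<^sup>2"
    show "summable (\<lambda>k::nat. C * (\<psi> k / (1 + real k)\<^sup>2))"
      by (intro summable_mult summable_of_convergent[OF nonneg incr I])
    \<comment> \<open>Both \<open>w - k\<close> and \<open>w + k\<close> have imaginary part 1,
      hence modulus at least 1, and modulus at least \<open>k - cmod w\<close>; so each is at least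
      a fixed multiple of \<open>1 + k\<close>.\<close>
    have far: "1 + real k \<le> cmod v * (2 + cmod w)" if v: "Im v = 1" and vw: "v = w - of_nat k \<or> v = w + of_nat k" for k v
    proof -
      have v1: "1 \<le> cmod v" using abs_Im_le_cmod[of v] v by simp
      have "real k = cmod (of_nat k)" by simp
      also have "\<dots> \<le> cmod v + cmod w"
        using vw norm_triangle_ineq4[of w v] norm_triangle_ineq4[of v w] by (auto simp: add.commute)
      finally have "1 + real k \<le> cmod v + (cmod v + cmod w)" using v1 by simp
      also have "\<dots> \<le> cmod v + (cmod v + cmod v * cmod w)"
        using mult_right_mono[OF v1, of "cmod w"] by simp
      finally show ?thesis by (simp add: algebra_simps)
    qed
    have "cmod (u k (of_real x)) \<le> C * (\<psi> k / (1 + real k)\<^sup>2)" for k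
    proof -
      let ?a = "w - of_nat k" and ?b = "w + of_nat k"
      have nz: "?a \<noteq> 0" "?b \<noteq> 0" by (auto simp: w_def complex_eq_iff)
      have "(1 + real k) * (1 + real k) \<le> (cmod ?a * (2 + cmod w)) * (cmod ?b * (2 + cmod w))"
        by (intro mult_mono far) (auto simp: w_def)
      then have le: "(1 + real k)\<^sup>2 \<le> (2 + cmod w)\<^sup>2 * (cmod ?a * cmod ?b)"
        by (simp add: power2_eq_square mult_ac)
      have "1 / (cmod ?a * cmod ?b) \<le> (2 + cmod w)\<^sup>2 / (1 + real k)\<^sup>2"
        using le nz by (simp add: divide_simps)
      moreover have "u k (of_real x) = of_real (\<psi> k) * (2 * \<i> * w / (?a * ?b))"
        using nz by (simp add: u_def w_def[symmetric] divide_simps) (simp add: w_def algebra_simps)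
      then have "cmod (u k (of_real x)) = \<psi> k * (2 * cmod w) * (1 / (cmod ?a * cmod ?b))"
        using nonneg[of "real k"] by (simp add: norm_mult norm_divide)
      ultimately have "cmod (u k (of_real x)) \<le> \<psi> k * (2 * cmod w) * ((2 + cmod w)\<^sup>2 / (1 + real k)\<^sup>2)"
        using nonneg[of "real k"] by (simp only: mult_left_mono mult_nonneg_nonneg norm_ge_zero zero_le_numeral)
      then show ?thesis by (simp add: C_def mult_ac)
    qed
    then show "\<exists>N. \<forall>k\<ge>N. cmod (u k (of_real x)) \<le> C * (\<psi> k / (1 + real k)\<^sup>2)" by blast
  qed
  define f where "f = (\<lambda>x::real. exp (- 2 * (\<Sum>k. u k (of_real x))) / (of_real x + \<i>)\<^sup>2)"
  have [measurable]: "(\<lambda>x. u k (complex_of_real x)) \<in> borel_measurable borel" for k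
    unfolding u_def by measurable
  have [measurable]: "f \<in> borel_measurable borel" unfolding f_def by measurable
  have wne: "complex_of_real x + \<i> \<noteq> 0" for x by (simp add: complex_eq_iff)
  then have f0: "f x \<noteq> 0" for x by (simp add: f_def)
  have sq: "(cmod (of_real x + \<i>))\<^sup>2 = 1 + x\<^sup>2" for x :: real by (simp add: cmod_power2 add.commute)
  show thesis
  proof (rule that[of f])
    show "f \<in> borel_measurable borel" by measurable
    show "f x \<noteq> 0" for x by (rule f0)
    show "cmod (f x) \<le> exp (- \<psi> \<bar>x\<bar>) / (1 + x\<^sup>2)" for x
    proof -
      define m where "m = nat \<lceil>\<bar>x\<bar>\<rceil>"
      have m: "\<bar>x\<bar> \<le> real m" "real m \<le> \<bar>x\<bar> + 1" by (simp_all add: m_def)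
      define v where "v = (if 0 \<le> x then of_real x + \<i> - of_nat m else of_real x + \<i> + of_nat m)"
      have v: "Im v = 1" "(Re v)\<^sup>2 = (real m - \<bar>x\<bar>)\<^sup>2" by (auto simp: v_def power2_eq_square algebra_simps)
      have "(real m - \<bar>x\<bar>)\<^sup>2 \<le> 1" using m by (intro power_le_one) auto
      then have "(cmod v)\<^sup>2 \<le> 2" by (simp add: cmod_power2 v)
      moreover have "0 < (cmod v)\<^sup>2" using v(1) by auto
      ultimately have "1 / 2 \<le> Re (\<i> / v)" unfolding Re_ii_divide v(1) by (intro frac_le) auto
      also have "\<dots> \<le> Re (\<i> / (of_real x + \<i> - of_nat m)) + Re (\<i> / (of_real x + \<i> + of_nat m))"
        using re[of "of_real x" m] by (simp add: v_def)
      finally have "\<psi> (real m) * (1 / 2) \<le> \<psi> (real m) * (Re (\<i> / (of_real x + \<i> - of_nat m)) + Re (\<i> / (of_real x + \<i> + of_nat m)))"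
        using nonneg[of "real m"] by (intro mult_left_mono) auto
      also have "\<dots> = Re (u m (of_real x))" by (simp add: u_def)
      finally have "\<psi> \<bar>x\<bar> / 2 \<le> (\<Sum>k\<in>{m}. Re (u k (of_real x)))"
        using mono_onD[OF incr, of "\<bar>x\<bar>" "real m"] m by auto
      also have "\<dots> \<le> (\<Sum>k. Re (u k (of_real x)))"
        by (rule sum_le_suminf) (use Re_u sm in \<open>auto intro: summable_Re\<close>)
      also have "\<dots> = Re (\<Sum>k. u k (of_real x))" by (rule Re_suminf[symmetric, OF sm])
      finally have "exp (- 2 * Re (\<Sum>k. u k (of_real x))) \<le> exp (- \<psi> \<bar>x\<bar>)" by simp
      then show ?thesis
        unfolding f_def norm_divide norm_power sq by (intro divide_right_mono) auto
    qed
    fix l :: real assume l: "l \<le> 0"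
    \<comment> \<open>Cauchy's theorem is used for the partial sums alone. The limit is taken on the
      real line, with a bound uniform in \<open>N\<close>.\<close>
    have "(\<lambda>N. \<integral>x. F N l (of_real x) \<partial>lborel) \<longlonglongrightarrow> (\<integral>x. exp (- (\<i> * of_real (l * x))) * f x \<partial>lborel)"
    proof (rule integral_dominated_convergence[OF _ _ integrable_Cauchy_kernel])
      show "AE x in lborel. (\<lambda>N. F N l (of_real x)) \<longlonglongrightarrow> exp (- (\<i> * of_real (l * x))) * f x"
      proof (rule AE_I2)
        fix x :: real
        have "(\<lambda>N. exp (- (\<i> * of_real (l * x))) * (exp (- 2 * (\<Sum>k<N. u k (of_real x))) / (of_real x + \<i>)\<^sup>2))
          \<longlonglongrightarrow> exp (- (\<i> * of_real (l * x))) * f x"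
          unfolding f_def using wne[of x] by (intro tendsto_intros summable_LIMSEQ sm) simp
        then show "(\<lambda>N. F N l (of_real x)) \<longlonglongrightarrow> exp (- (\<i> * of_real (l * x))) * f x"
          by (simp add: F_def mult_ac)
      qed
      show "AE x in lborel. norm (F N l (of_real x)) \<le> 1 / (1 + x\<^sup>2)" for N
        using bound[OF _ l] sq by (intro AE_I2) (metis Im_complex_of_real order_refl)
      show "(\<lambda>x. F N l (complex_of_real x)) \<in> borel_measurable lborel" for N
        unfolding F_def by measurable
    qed measurable
    then show "(\<integral>x. exp (- (\<i> * of_real (l * x))) * f x \<partial>lborel) = 0"
      by (simp add: zero[OF l] LIMSEQ_const_iff)
  qed
qed

theorem ex_complex_measure_of_convergent:
  fixes \<psi> :: "real \<Rightarrow> real"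
  assumes nonneg: "\<And>x. 0 \<le> x \<Longrightarrow> 0 \<le> \<psi> x"
    and incr: "mono_on {0..} \<psi>"
    and I: "(\<integral>\<^sup>+x\<in>{0..}. ennreal (\<psi> x / (1 + x\<^sup>2)) \<partial>lborel) < \<infinity>"
  shows "\<exists>\<mu> :: (real ^ 'n) set \<Rightarrow> complex. complex_measure borel \<mu> \<and> (\<exists>E\<in>sets borel. \<mu> E \<noteq> 0) \<and>
    (\<integral>\<^sup>+x. ennreal (exp (\<psi> (norm x))) \<partial>total_variation borel \<mu>) < \<infinity> \<and>
    (\<forall>l. (\<forall>j. l $ j \<le> 0) \<longrightarrow> fourier_transform \<mu> l = 0)"
proof -
  obtain f :: "real \<Rightarrow> complex" where [measurable]: "f \<in> borel_measurable borel" and f0: "\<And>x. f x \<noteq> 0"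
    and f_le: "\<And>x. cmod (f x) \<le> exp (- \<psi> \<bar>x\<bar>) / (1 + x\<^sup>2)"
    and f_zero: "\<And>l. l \<le> 0 \<Longrightarrow> (\<integral>x. exp (- (\<i> * of_real (l * x))) * f x \<partial>lborel) = 0"
  proof (rule rapidly_decreasing_one_sided_spectrum[OF nonneg incr I])
    fix f :: "real \<Rightarrow> complex"
    assume "f \<in> borel_measurable borel" "\<And>x. f x \<noteq> 0" "\<And>x. cmod (f x) \<le> exp (- \<psi> \<bar>x\<bar>) / (1 + x\<^sup>2)"
      "\<And>l. l \<le> 0 \<Longrightarrow> (\<integral>x. exp (- (\<i> * of_real (l * x))) * f x \<partial>lborel) = 0"
    then show thesis by (rule that)
  qed
  have Cauchy_fin: "(\<integral>\<^sup>+x. ennreal (1 / (1 + x\<^sup>2)) \<partial>lborel) < \<infinity>"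
    using integrable_Cauchy_kernel by (simp add: integrable_iff_bounded)
  obtain i :: 'n where True by simp
  define e :: "real \<Rightarrow> real ^ 'n" where "e = (\<lambda>x. x *\<^sub>R axis i 1)"
  have e_nth: "e x $ i = x" for x by (simp add: e_def axis_def)
  have norm_e: "norm (e x) = \<bar>x\<bar>" for x by (simp add: e_def)
  have e_inner: "l \<bullet> e x = l $ i * x" for l x by (simp add: e_def inner_axis)
  have [measurable]: "e \<in> borel_measurable borel"
    unfolding e_def by measurable
  \<comment> \<open>The candidate is assembled in polar form: \<open>M\<close> carries the modulus
    of \<open>f\<close> along the axis and \<open>s\<close> its phase.\<close>
  define N where "N = density lborel (\<lambda>x. ennreal (cmod (f x)))"
  define M where "M = distr N borel e"
  have sets_M [measurable_cong]: "sets M = sets borel" by (simp add: M_def)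
  have sets_N [measurable_cong]: "sets N = sets borel" by (simp add: N_def)
  have "emeasure N (space N) = (\<integral>\<^sup>+x. ennreal (cmod (f x)) \<partial>lborel)"
    by (simp add: N_def emeasure_density)
  also have "\<dots> \<le> (\<integral>\<^sup>+x. ennreal (1 / (1 + x\<^sup>2)) \<partial>lborel)"
  proof (intro nn_integral_mono ennreal_leI)
    fix x :: real
    have "exp (- \<psi> \<bar>x\<bar>) / (1 + x\<^sup>2) \<le> 1 / (1 + x\<^sup>2)"
      using nonneg[of "\<bar>x\<bar>"] by (intro divide_right_mono) auto
    then show "cmod (f x) \<le> 1 / (1 + x\<^sup>2)" using f_le[of x] by linarith
  qed
  finally have "emeasure N (space N) < \<infinity>" using Cauchy_fin by (rule le_less_trans)
  then have "finite_measure N" by (intro finite_measureI) auto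
  then have "finite_measure M" unfolding M_def by (rule finite_measure.finite_measure_distr) measurable
  then interpret M: finite_measure M .
  define s where "s = (\<lambda>x :: real ^ 'n. f (x $ i) / of_real (cmod (f (x $ i))))"
  have [measurable]: "(\<lambda>x :: real ^ 'n. x $ i) \<in> borel_measurable borel"
    by (intro borel_measurable_continuous_onI continuous_intros)
  have [measurable]: "s \<in> borel_measurable borel" unfolding s_def by measurable
  have s1: "cmod (s x) = 1" for x using f0 by (simp add: s_def norm_divide)
  have s: "integrable M s" by (rule M.integrable_const_bound[of _ 1]) (use s1 in auto)
  define \<mu> where "\<mu> = (\<lambda>E. LINT x:E|M. s x)"
  \<comment> \<open>\<open>M\<close> and \<open>borel\<close> have the same measurable sets, and the
    notions in question depend on nothing else.\<close>
  have cong_cm: "complex_measure M = complex_measure borel"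
    by (intro ext) (simp add: complex_measure_def sets_M)
  have space_M: "space M = space borel" using sets_M by (rule sets_eq_imp_space_eq)
  have cong_tv: "total_variation M \<mu> = total_variation borel \<mu>"
    by (simp add: total_variation_def countable_partitions_def sets_M space_M)
  have cong_int: "complex_measure_integral M \<mu> = complex_measure_integral borel \<mu>"
    by (intro ext) (simp add: complex_measure_integral_def polar_density_def cong_tv sets_M)
  have change: "(\<integral>x. g x * s x \<partial>M) = (\<integral>x. g (e x) * f x \<partial>lborel)" if [measurable]: "g \<in> borel_measurable borel" for g
  proof -
    have "(\<integral>x. g x * s x \<partial>M) = (\<integral>x. g (e x) * s (e x) \<partial>N)"
      unfolding M_def by (rule integral_distr) measurable
    also have "\<dots> = (\<integral>x. cmod (f x) *\<^sub>R (g (e x) * s (e x)) \<partial>lborel)"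
      unfolding N_def by (rule integral_density) auto
    also have "\<dots> = (\<integral>x. g (e x) * f x \<partial>lborel)"
      using f0 by (intro Bochner_Integration.integral_cong) (auto simp: s_def e_nth scaleR_conv_of_real)
    finally show ?thesis .
  qed
  have "\<exists>E\<in>sets borel. \<mu> E \<noteq> 0"
  proof (rule ccontr)
    assume "\<not> ?thesis"
    then have "AE x in M. s x = 0"
      using sets_M by (intro M.density_zero[OF s]) (auto simp: \<mu>_def)
    \<comment> \<open>A unimodular density that is zero almost everywhere forces \<open>M\<close> to
      be null; as \<open>f\<close> has no zeros, Lebesgue measure would then be null.\<close>
    then have "AE x in M. False" by eventually_elim (use s1 in \<open>metis norm_zero zero_neq_one\<close>)
    then have "AE x in N. False" unfolding M_def by (subst (asm) AE_distr_iff) auto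
    then have "AE x in lborel. cmod (f x) = 0" unfolding N_def by (subst (asm) AE_density) (auto simp: f0)
    then have "AE x::real in lborel. False" by eventually_elim (simp add: f0)
    then show False using emeasure_eq_0_AE[of "\<lambda>_. True" "lborel :: real measure"] by (simp add: emeasure_lborel_UNIV)
  qed
  moreover have "complex_measure borel \<mu>"
    using complex_measure_density[OF s] by (simp add: \<mu>_def cong_cm)
  moreover have "(\<integral>\<^sup>+x. ennreal (exp (\<psi> (norm x))) \<partial>total_variation borel \<mu>) < \<infinity>"
  proof -
    \<comment> \<open>Nothing is known about \<psi> on the negative axis; composing with
      \<open>max 0\<close> gives a globally monotone, hence Borel, function that agrees with it on
      norms.\<close>
    have "(\<lambda>x. \<psi> (max 0 x)) \<in> borel_measurable borel"
      by (intro borel_measurable_mono monoI mono_onD[OF incr]) auto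
    then have "(\<lambda>x. \<psi> (max 0 (norm x))) \<in> borel_measurable (borel :: (real ^ 'n) measure)"
      by (rule measurable_compose[rotated]) measurable
    then have [measurable]: "(\<lambda>x :: real ^ 'n. \<psi> (norm x)) \<in> borel_measurable borel" by (simp add: max_def)
    have "(\<lambda>x. \<psi> (norm (e x))) \<in> borel_measurable borel" by measurable
    then have [measurable]: "(\<lambda>x::real. \<psi> \<bar>x\<bar>) \<in> borel_measurable borel" by (simp add: norm_e)
    have "total_variation M \<mu> \<le> M"
    proof (subst le_measure, simp, rule ballI)
      fix E assume "E \<in> sets (total_variation M \<mu>)"
      then have E: "E \<in> sets M" by simp
      have "emeasure (total_variation M \<mu>) E \<le> (\<integral>\<^sup>+x\<in>E. ennreal (cmod (s x)) \<partial>M)"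
        unfolding \<mu>_def by (rule total_variation_density_le[OF s E])
      also have "\<dots> = emeasure M E" using E by (simp add: s1)
      finally show "emeasure (total_variation M \<mu>) E \<le> emeasure M E" .
    qed
    then have "(\<integral>\<^sup>+x. ennreal (exp (\<psi> (norm x))) \<partial>total_variation M \<mu>) \<le> (\<integral>\<^sup>+x. ennreal (exp (\<psi> (norm x))) \<partial>M)"
      by (intro nn_integral_mono_measure) simp
    also have "\<dots> = (\<integral>\<^sup>+x. ennreal (cmod (f x)) * ennreal (exp (\<psi> \<bar>x\<bar>)) \<partial>lborel)"
      unfolding M_def N_def by (simp add: nn_integral_distr nn_integral_density norm_e)
    also have "\<dots> \<le> (\<integral>\<^sup>+x. ennreal (1 / (1 + x\<^sup>2)) \<partial>lborel)"
    proof (rule nn_integral_mono)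
      fix x :: real
      have "cmod (f x) * exp (\<psi> \<bar>x\<bar>) \<le> exp (- \<psi> \<bar>x\<bar>) / (1 + x\<^sup>2) * exp (\<psi> \<bar>x\<bar>)"
        by (intro mult_right_mono f_le) auto
      also have "\<dots> = 1 / (1 + x\<^sup>2)" by (simp add: exp_minus)
      finally show "ennreal (cmod (f x)) * ennreal (exp (\<psi> \<bar>x\<bar>)) \<le> ennreal (1 / (1 + x\<^sup>2))"
        by (simp add: ennreal_mult[symmetric] ennreal_leI)
    qed
    finally show ?thesis using Cauchy_fin by (simp add: cong_tv)
  qed
  \<comment> \<open>The measure sits on the \<open>i\<close>-th axis, so its transform depends on
    \<open>l $ i\<close> alone and vanishes on a half-space, which contains a product of
    half-lines.\<close>
  moreover have "fourier_transform \<mu> l = 0" if "l $ i \<le> 0" for l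
  proof -
    have meas: "(\<lambda>x. exp (- (\<i> * complex_of_real (l \<bullet> x)))) \<in> borel_measurable borel" by measurable
    have "fourier_transform \<mu> l = (\<integral>x. exp (- (\<i> * complex_of_real (l \<bullet> x))) * s x \<partial>M)"
      unfolding fourier_transform_def cong_int[symmetric]
      by (rule complex_measure_integral_density[OF M.sigma_finite_measure_axioms s, folded \<mu>_def]) (use meas in simp)
    also have "\<dots> = (\<integral>x. exp (- (\<i> * complex_of_real (l $ i * x))) * f x \<partial>lborel)"
      unfolding change[OF meas] e_inner ..
    also have "\<dots> = 0" by (rule f_zero[OF that])
    finally show ?thesis .
  qed
  ultimately show ?thesis by blast
qed

theorem theorem2p4:
  fixes \<psi> :: "real \<Rightarrow> real" and I :: ennreal
  assumes nonneg: "\<And>x. 0 \<le> x \<Longrightarrow> 0 \<le> \<psi> x"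
    and incr: "mono_on {0..} \<psi>"
    and lim: "filterlim \<psi> at_top at_top"
    and I_eq: "I = (\<integral>\<^sup>+x\<in>{0..}. ennreal (\<psi> x / (1 + x\<^sup>2)) \<partial>lborel)"
  shows
    "(I = \<infinity> \<longrightarrow>
       (\<forall>(\<mu> :: (real ^ 'n) set \<Rightarrow> complex) (\<Lambda> :: 'n \<Rightarrow> real set).
          complex_measure borel \<mu> \<longrightarrow>
          (\<integral>\<^sup>+x. ennreal (exp (\<psi> (norm x))) \<partial>total_variation borel \<mu>) < \<infinity> \<longrightarrow>
          (\<forall>j. closed (\<Lambda> j) \<and> emeasure lborel (\<Lambda> j) > 0) \<longrightarrow>
          (\<forall>l. (\<forall>j. l $ j \<in> \<Lambda> j) \<longrightarrow> fourier_transform \<mu> l = 0) \<longrightarrow>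
          (\<forall>E\<in>sets borel. \<mu> E = 0)))
     \<and>
     (I < \<infinity> \<longrightarrow>
       (\<exists>(\<mu> :: (real ^ 'n) set \<Rightarrow> complex) (\<Lambda> :: 'n \<Rightarrow> real set).
          complex_measure borel \<mu> \<and>
          (\<exists>E\<in>sets borel. \<mu> E \<noteq> 0) \<and>
          (\<integral>\<^sup>+x. ennreal (exp (\<psi> (norm x))) \<partial>total_variation borel \<mu>) < \<infinity> \<and>
          (\<forall>j. closed (\<Lambda> j) \<and> emeasure lborel (\<Lambda> j) > 0) \<and>
          (\<forall>l. (\<forall>j. l $ j \<in> \<Lambda> j) \<longrightarrow> fourier_transform \<mu> l = 0)))"
proof (intro conjI impI allI ballI)
  fix \<mu> :: "(real ^ 'n) set \<Rightarrow> complex" and \<Lambda> :: "'n \<Rightarrow> real set" and E :: "(real ^ 'n) set"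
  assume "I = \<infinity>" "complex_measure borel \<mu>"
    "(\<integral>\<^sup>+x. ennreal (exp (\<psi> (norm x))) \<partial>total_variation borel \<mu>) < \<infinity>"
    "\<forall>j. closed (\<Lambda> j) \<and> emeasure lborel (\<Lambda> j) > 0"
    "\<forall>l. (\<forall>j. l $ j \<in> \<Lambda> j) \<longrightarrow> fourier_transform \<mu> l = 0" "E \<in> sets borel"
  then show "\<mu> E = 0"
    using I_eq by (intro complex_measure_eq_0_of_divergent[OF nonneg incr lim, of \<mu> \<Lambda>]) auto
next
  assume "I < \<infinity>"
  then have "(\<integral>\<^sup>+x\<in>{0..}. ennreal (\<psi> x / (1 + x\<^sup>2)) \<partial>lborel) < \<infinity>" using I_eq by simp
  from ex_complex_measure_of_convergent[OF nonneg incr this]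
  obtain \<mu> :: "(real ^ 'n) set \<Rightarrow> complex" where \<mu>: "complex_measure borel \<mu>" "\<exists>E\<in>sets borel. \<mu> E \<noteq> 0"
    "(\<integral>\<^sup>+x. ennreal (exp (\<psi> (norm x))) \<partial>total_variation borel \<mu>) < \<infinity>"
    "\<And>l. (\<And>j. l $ j \<le> 0) \<Longrightarrow> fourier_transform \<mu> l = 0" by blast
  have "0 < emeasure lborel {-1..0::real}" by simp
  also have "\<dots> \<le> emeasure lborel {..0::real}" by (rule emeasure_mono) auto
  finally have "0 < emeasure lborel {..0::real}" .
  then show "\<exists>(\<mu> :: (real ^ 'n) set \<Rightarrow> complex) (\<Lambda> :: 'n \<Rightarrow> real set).
      complex_measure borel \<mu> \<and>
      (\<exists>E\<in>sets borel. \<mu> E \<noteq> 0) \<and>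
      (\<integral>\<^sup>+x. ennreal (exp (\<psi> (norm x))) \<partial>total_variation borel \<mu>) < \<infinity> \<and>
      (\<forall>j. closed (\<Lambda> j) \<and> emeasure lborel (\<Lambda> j) > 0) \<and>
      (\<forall>l. (\<forall>j. l $ j \<in> \<Lambda> j) \<longrightarrow> fourier_transform \<mu> l = 0)"
    using \<mu> by (intro exI[of _ \<mu>] exI[of _ "\<lambda>_. {..0}"]) auto
qed

end
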